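(* Let $G$ be a finite simple graph without isolated vertices on $[n]$, and let $\mathbf{k}=(k_1,\ldots,k_n)\in\mathbb{N}^n$ be a vector such that $1\le k_i\le\deg_G(i)+1$ for all $i$. Let $C$ be an $\mathbf{m}$-vertex cover of $G$, where $\mathbf{m}=(m_1,\ldots,m_n)$ with $m_i=k_i-1$ for all $i$. Then (a) $\operatorname{proj\,dim}(S/\mathrm{NI}_{\mathbf{k}}(G))\ge n-|C|$; (b) $\operatorname{depth}(S/\mathrm{NI}_{\mathbf{k}}(G))\le |C|$.
   Context: $K$ is a field and $S=K[x_1,\ldots,x_n]$. $N_G[i]$ is the closed neighborhood of vertex $i$ and $\mathbf{x}_W=\prod_{j\in W}x_j$ for $W\subseteq[n]$. The $\mathbf{k}$-neighborhood ideal of $G$ is $$\mathrm{NI}_{\mathbf{k}}(G)=\sum_{i=1}^n\big(\mathbf{x}_W:\ W\subseteq N_G[i],\ |W|=k_i\big)\subseteq S.$$ For a vector $\mathbf{m}=(m_1,\ldots,m_n)\in\mathbb{Z}^n$ with $0\le m_i\le\deg_G(i)$, a subset $C\subseteq[n]$ is called an $\mathbf{m}$-vertex cover of $G$ if $|N_G[i]\cap C|\le m_i$ for all $i\in C$ and $|N_G[i]\cap C|=m_i$ for all $i\notin C$. *)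

theory Defs
  imports
    "HOL-Algebra.Algebra"
    "HOL-Algebra.Algebraic_Closure_Type"
    "HOL-Library.Poly_Mapping"
    "HOL-Library.Extended_Nat"
    "HOL-Library.Cardinality"
begin

section \<open>Modules over a commutative ring\<close>

text \<open>Only the fields carrier, zero, add and smult of a module record are meaningful; the fields
  mult and one, inherited from rings, are not mentioned by the locale \<^locale>\<open>module\<close>.\<close>

definition module_hom ::
    "('a, 'r) ring_scheme \<Rightarrow> ('a, 'b, 'm) module_scheme \<Rightarrow> ('a, 'c, 'n) module_scheme \<Rightarrow> ('b \<Rightarrow> 'c) set"
  where "module_hom R M N = {h \<in> carrier M \<rightarrow> carrier N.
    (\<forall>x\<in>carrier M. \<forall>y\<in>carrier M. h (x \<oplus>\<^bsub>M\<^esub> y) = h x \<oplus>\<^bsub>N\<^esub> h y) \<and>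
    (\<forall>a\<in>carrier R. \<forall>x\<in>carrier M. h (a \<odot>\<^bsub>M\<^esub> x) = a \<odot>\<^bsub>N\<^esub> h x)}"

definition regular_module :: "'a ring \<Rightarrow> ('a, 'a) module"
  where "regular_module R =
    \<lparr>carrier = carrier R, monoid.mult = monoid.mult R, monoid.one = \<one>\<^bsub>R\<^esub>,
     ring.zero = \<zero>\<^bsub>R\<^esub>, ring.add = ring.add R, module.smult = monoid.mult R\<rparr>"

definition quotient_module :: "('a, 'b) module \<Rightarrow> 'b set \<Rightarrow> ('a, 'b set) module"
  where "quotient_module M N =
    \<lparr>carrier = a_rcosets\<^bsub>M\<^esub> N, monoid.mult = undefined, monoid.one = undefined,
     ring.zero = N, ring.add = set_add M,
     module.smult = (\<lambda>a Y. \<Union>y\<in>Y. N +>\<^bsub>M\<^esub> (a \<odot>\<^bsub>M\<^esub> y))\<rparr>"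

text \<open>The free module with basis indexed by \<open>A\<close>: finitely supported families indexed by \<open>A\<close>,
  extended by zero outside \<open>A\<close>.\<close>

definition free_module :: "('a, 'r) ring_scheme \<Rightarrow> 'i set \<Rightarrow> ('a, 'i \<Rightarrow> 'a) module"
  where "free_module R A =
    \<lparr>carrier = {f. (\<forall>i. f i \<in> carrier R) \<and> (\<forall>i. i \<notin> A \<longrightarrow> f i = \<zero>\<^bsub>R\<^esub>) \<and> finite {i. f i \<noteq> \<zero>\<^bsub>R\<^esub>}},
     monoid.mult = undefined, monoid.one = undefined,
     ring.zero = (\<lambda>i. \<zero>\<^bsub>R\<^esub>), ring.add = (\<lambda>f g i. f i \<oplus>\<^bsub>R\<^esub> g i),
     module.smult = (\<lambda>a f i. a \<otimes>\<^bsub>R\<^esub> f i)\<rparr>"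

text \<open>Projective means direct summand of a free module. Index sets in the carrier type of \<open>P\<close> lose
  nothing: if \<open>P\<close> is projective, then it is a summand of the free module with basis \<open>carrier P\<close>.\<close>

definition projective_module :: "('a, 'r) ring_scheme \<Rightarrow> ('a, 'b) module \<Rightarrow> bool"
  where "projective_module R P \<longleftrightarrow> module R P \<and>
    (\<exists>(A :: 'b set) \<iota> \<pi>. \<iota> \<in> module_hom R P (free_module R A) \<and>
       \<pi> \<in> module_hom R (free_module R A) P \<and> (\<forall>x\<in>carrier P. \<pi> (\<iota> x) = x))"

definition projective_resolution ::
    "('a, 'r) ring_scheme \<Rightarrow> ('a, 'b) module \<Rightarrow>
     (nat \<Rightarrow> ('a, 'u) module) \<Rightarrow> (nat \<Rightarrow> 'u \<Rightarrow> 'u) \<Rightarrow> ('u \<Rightarrow> 'b) \<Rightarrow> bool"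
  where "projective_resolution R M P \<delta> \<epsilon> \<longleftrightarrow>
    (\<forall>i. projective_module R (P i)) \<and>
    \<epsilon> \<in> module_hom R (P 0) M \<and>
    (\<forall>i. \<delta> i \<in> module_hom R (P (Suc i)) (P i)) \<and>
    \<epsilon> ` carrier (P 0) = carrier M \<and>
    \<delta> 0 ` carrier (P (Suc 0)) = a_kernel (P 0) M \<epsilon> \<and>
    (\<forall>i. \<delta> (Suc i) ` carrier (P (Suc (Suc i))) = a_kernel (P (Suc i)) (P i) (\<delta> i))"

text \<open>The least length of a projective resolution, infinite if there is no finite one. HOL cannot
  quantify over all types at once, so the type \<open>'u\<close> of the elements of the resolving modules is a
  parameter. The value is the projective dimension as soon as \<open>'u\<close> is large enough to carry copies
  of the modules in some resolution of minimal length, and can only be too large otherwise. A lower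
  bound that holds for every \<open>'u\<close> is a lower bound on the length of every projective resolution.\<close>

definition proj_dim :: "'u itself \<Rightarrow> ('a, 'r) ring_scheme \<Rightarrow> ('a, 'b) module \<Rightarrow> enat"
  where "proj_dim _ R M = Inf {enat d | d.
    \<exists>(P :: nat \<Rightarrow> ('a, 'u) module) \<delta> \<epsilon>. projective_resolution R M P \<delta> \<epsilon> \<and>
      (\<forall>i>d. carrier (P i) = {\<zero>\<^bsub>P i\<^esub>})}"

text \<open>\<open>(x\<^sub>1, \<dots>, x\<^sub>r)M\<close>\<close>

definition seq_submodule :: "('a, 'b) module \<Rightarrow> 'a list \<Rightarrow> 'b set"
  where "seq_submodule M xs =
    {\<Oplus>\<^bsub>M\<^esub>j\<in>{..<length xs}. (xs ! j) \<odot>\<^bsub>M\<^esub> m j | m. m \<in> {..<length xs} \<rightarrow> carrier M}"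

text \<open>The middle condition says that multiplication by \<open>xs ! i\<close> is injective on the quotient of
  \<open>M\<close> by the submodule generated by the preceding entries.\<close>

definition regular_sequence :: "('a, 'r) ring_scheme \<Rightarrow> ('a, 'b) module \<Rightarrow> 'a list \<Rightarrow> bool"
  where "regular_sequence R M xs \<longleftrightarrow>
    set xs \<subseteq> carrier R \<and>
    (\<forall>i<length xs. \<forall>m\<in>carrier M.
       (xs ! i) \<odot>\<^bsub>M\<^esub> m \<in> seq_submodule M (take i xs) \<longrightarrow> m \<in> seq_submodule M (take i xs)) \<and>
    seq_submodule M xs \<noteq> carrier M"

text \<open>The supremum of the lengths of \<open>M\<close>-regular sequences in the ideal \<open>J\<close>.\<close>

definition depth :: "('a, 'r) ring_scheme \<Rightarrow> 'a set \<Rightarrow> ('a, 'b) module \<Rightarrow> enat"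
  where "depth R J M = Sup {enat (length xs) | xs. regular_sequence R M xs \<and> set xs \<subseteq> J}"


section \<open>The polynomial ring\<close>

text \<open>The variables of \<open>K[x\<^sub>1, \<dots>, x\<^sub>n]\<close> are indexed by a finite type \<open>'n\<close> with \<open>n\<close> elements, which
  plays the role of \<open>[n]\<close>. Exponent vectors are elements of \<open>'n \<Rightarrow>\<^sub>0 nat\<close>.\<close>

type_synonym ('n, 'k) mpoly = "('n \<Rightarrow>\<^sub>0 nat) \<Rightarrow>\<^sub>0 'k"

abbreviation mpoly_ring :: "('n::finite, 'k::field) mpoly ring"
  where "mpoly_ring \<equiv> ring_of_type_algebra"

definition mvar :: "'n::finite \<Rightarrow> ('n, 'k::field) mpoly"
  where "mvar j = Poly_Mapping.single (Poly_Mapping.single j 1) 1"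

definition squarefree_monomial :: "'n::finite set \<Rightarrow> ('n, 'k::field) mpoly"
  where "squarefree_monomial W = (\<Prod>j\<in>W. mvar j)"

definition irrelevant_ideal :: "('n::finite, 'k::field) mpoly set"
  where "irrelevant_ideal = genideal mpoly_ring (range mvar)"

text \<open>The depth of a module over the polynomial ring is taken with respect to \<open>(x\<^sub>1, \<dots>, x\<^sub>n)\<close>.\<close>

abbreviation poly_depth :: "(('n::finite, 'k::field) mpoly, 'b) module \<Rightarrow> enat"
  where "poly_depth M \<equiv> depth mpoly_ring irrelevant_ideal M"


section \<open>Graphs, vertex covers and neighborhood ideals\<close>

text \<open>A simple graph with vertex set \<open>'n\<close> is given by its set of edges.\<close>

definition simple_graph :: "'n::finite set set \<Rightarrow> bool"
  where "simple_graph E \<longleftrightarrow> (\<forall>e\<in>E. card e = 2)"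

definition neighbors :: "'n::finite set set \<Rightarrow> 'n \<Rightarrow> 'n set"
  where "neighbors E i = {j. {i, j} \<in> E}"

definition closed_neighborhood :: "'n::finite set set \<Rightarrow> 'n \<Rightarrow> 'n set"
  where "closed_neighborhood E i = insert i (neighbors E i)"

definition vertex_degree :: "'n::finite set set \<Rightarrow> 'n \<Rightarrow> nat"
  where "vertex_degree E i = card (neighbors E i)"

definition isolated_vertex :: "'n::finite set set \<Rightarrow> 'n \<Rightarrow> bool"
  where "isolated_vertex E i \<longleftrightarrow> neighbors E i = {}"

definition m_vertex_cover :: "'n::finite set set \<Rightarrow> ('n \<Rightarrow> int) \<Rightarrow> 'n set \<Rightarrow> bool"
  where "m_vertex_cover E m C \<longleftrightarrow>
    (\<forall>i. 0 \<le> m i \<and> m i \<le> int (vertex_degree E i)) \<and>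
    (\<forall>i\<in>C. int (card (closed_neighborhood E i \<inter> C)) \<le> m i) \<and>
    (\<forall>i. i \<notin> C \<longrightarrow> int (card (closed_neighborhood E i \<inter> C)) = m i)"

definition neighborhood_ideal_at ::
    "'n::finite set set \<Rightarrow> ('n \<Rightarrow> nat) \<Rightarrow> 'n \<Rightarrow> ('n, 'k::field) mpoly set"
  where "neighborhood_ideal_at E k i = genideal mpoly_ring
    {squarefree_monomial W | W. W \<subseteq> closed_neighborhood E i \<and> card W = k i}"

definition neighborhood_ideal :: "'n::finite set set \<Rightarrow> ('n \<Rightarrow> nat) \<Rightarrow> ('n, 'k::field) mpoly set"
  where "neighborhood_ideal E k =
    {\<Sum>i\<in>UNIV. f i | f. \<forall>i. f i \<in> neighborhood_ideal_at E k i}"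

definition neighborhood_quotient ::
    "'n::finite set set \<Rightarrow> ('n \<Rightarrow> nat) \<Rightarrow> (('n, 'k::field) mpoly, ('n, 'k) mpoly set) module"
  where "neighborhood_quotient E k =
    quotient_module (regular_module mpoly_ring) (neighborhood_ideal E k)"

end

theory Submission
  imports Defs "HOL-Library.Function_Algebras"
begin

text \<open>Write \<open>S\<close> for the polynomial ring, \<open>I\<close> for the neighborhood ideal, \<open>M = S/I\<close> and \<open>w = x\<^sub>C\<close>. The cover
conditions on vertices in \<open>C\<close> and outside \<open>C\<close> together say that no generator of \<open>I\<close> divides \<open>w\<close>,
and that \<open>x\<^sub>i w \<in> I\<close> for every \<open>i \<notin> C\<close>. So the class of \<open>w\<close> is a nonzero element of \<open>M\<close> that is
killed by the \<open>r = n - |C|\<close> variables outside \<open>C\<close>. Both bounds follow from the existence of such an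
element. The common tool is the Koszul cochain complex \<open>K(xs; M)\<close> of a list \<open>xs\<close> of ring elements;
an element killed by \<open>xs\<close> is a cocycle of degree \<open>0\<close>.

For the projective dimension, let \<open>ys\<close> be the variables outside \<open>C\<close>. They form a regular sequence
on \<open>S\<close>, so \<open>K(ys; S)\<close> is exact in degrees below \<open>r\<close>, and the same holds for free modules and their
direct summands. If \<open>M\<close> had a projective resolution of length \<open>d < r\<close>, then going down the
resolution one would lose one degree of exactness with each syzygy
(\<open>koszul_acyclic_quotient\<close>, \<open>koszul_acyclic_image\<close>), and \<open>r - d \<ge> 1\<close> degrees would be left for
\<open>M\<close>. Hence nothing but \<open>0\<close> in \<open>M\<close> would be killed by \<open>ys\<close>
(\<open>koszul_regular_kernel_of_short_resolution\<close>).

For the depth, suppose that \<open>M\<close> has a regular sequence of length greater than \<open>|C|\<close> in the irrelevant ideal.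
Multiplication by an element of \<open>(x\<^sub>1, \<dots>, x\<^sub>n)\<close> is homotopic to zero on \<open>K(x\<^sub>1, \<dots>, x\<^sub>n; M)\<close>, which
gives exactness of that complex in degrees up to \<open>|C|\<close> (\<open>koszul_acyclic_regular_step\<close>). The
\<open>|C|\<close> variables in \<open>C\<close> are then removed from the complex one at a time. Each removal costs one
degree: by the mapping cone sequence, the removed variable acts surjectively on the cohomology of
the smaller complex, and since this variable raises a grading that is bounded below, the cohomology
vanishes (\<open>koszul_acyclic_cone_step\<close>). What is left is exactness of \<open>K(ys; M)\<close> in degree \<open>0\<close>, which
the class of \<open>w\<close> contradicts.\<close>

section \<open>The Koszul complex\<close>

text \<open>A cochain is a function on subsets of the positions of \<open>xs\<close>, and a subset is encoded by its
characteristic \<^typ>\<open>bool list\<close>. With this encoding the Koszul complex of \<open>x # xs\<close> is visibly the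
mapping cone of multiplication by \<open>x\<close> on the Koszul complex of \<open>xs\<close>: a cochain is a pair of smaller
cochains, selected by the first bit, and no signs have to be tracked beyond the one of the cone.\<close>

fun koszul_d :: "('a \<Rightarrow> 'b \<Rightarrow> 'b) \<Rightarrow> 'a list \<Rightarrow> (bool list \<Rightarrow> 'b::ab_group_add) \<Rightarrow> bool list \<Rightarrow> 'b"
  where
    "koszul_d scale (x # xs) c (False # l) = koszul_d scale xs (\<lambda>m. c (False # m)) l"
  | "koszul_d scale (x # xs) c (True # l) =
       scale x (c (False # l)) - koszul_d scale xs (\<lambda>m. c (True # m)) l"
  | "koszul_d scale _ c _ = 0"

text \<open>The degree of such a list is the number of \<^const>\<open>True\<close> bits. The filtration by \<open>degree < s\<close> is used
instead of single degrees, because it makes statements about the empty range of degrees below \<open>0\<close>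
uniform: there the only cochain is zero.\<close>

definition cochains :: "nat \<Rightarrow> nat \<Rightarrow> 'b::zero set \<Rightarrow> (bool list \<Rightarrow> 'b) set"
  where "cochains n s N =
    {c. \<forall>l. c l \<in> N \<and> (c l \<noteq> 0 \<longrightarrow> length l = n \<and> count_list l True < s)}"

text \<open>For submodules \<open>L \<subseteq> N\<close> this says that the Koszul cohomology of \<open>N/L\<close> vanishes in all degrees below
\<open>s\<close>. Keeping \<open>N\<close> and \<open>L\<close> as sets in one ambient type allows both submodules and quotients to be
treated without changing types.\<close>

definition koszul_acyclic ::
    "('a \<Rightarrow> 'b \<Rightarrow> 'b) \<Rightarrow> 'a list \<Rightarrow> nat \<Rightarrow> 'b::ab_group_add set \<Rightarrow> 'b set \<Rightarrow> bool"
  where "koszul_acyclic scale xs s N L \<longleftrightarrow>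
    (\<forall>c\<in>cochains (length xs) s N. (\<forall>l. koszul_d scale xs c l \<in> L) \<longrightarrow>
      (\<exists>v\<in>cochains (length xs) (s - 1) N. \<forall>l. c l - koszul_d scale xs v l \<in> L))"

text \<open>The elements that act as zero on the Koszul cohomology of \<open>N/L\<close> in degrees below \<open>s\<close>.\<close>

definition koszul_null ::
    "('a \<Rightarrow> 'b \<Rightarrow> 'b) \<Rightarrow> 'a list \<Rightarrow> nat \<Rightarrow> 'b::ab_group_add set \<Rightarrow> 'b set \<Rightarrow> 'a set"
  where "koszul_null scale xs s N L = {f. \<forall>c\<in>cochains (length xs) s N.
    (\<forall>l. koszul_d scale xs c l \<in> L) \<longrightarrow>
      (\<exists>g\<in>cochains (length xs) (s - 1) N. \<forall>l. scale f (c l) - koszul_d scale xs g l \<in> L)}"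

lemma cochains_0: "c \<in> cochains n 0 N \<Longrightarrow> c = (\<lambda>_. 0)"
  by (auto simp: cochains_def)

lemma zero_cochain: "0 \<in> N \<Longrightarrow> (\<lambda>_. 0) \<in> cochains n s N"
  by (simp add: cochains_def)

lemma cochains_mono: "c \<in> cochains n s N \<Longrightarrow> s \<le> t \<Longrightarrow> N \<subseteq> N' \<Longrightarrow> c \<in> cochains n t N'"
  by (fastforce simp: cochains_def)

lemma cochains_False: "c \<in> cochains (Suc n) s N \<Longrightarrow> (\<lambda>m. c (False # m)) \<in> cochains n s N"
  by (force simp: cochains_def)

lemma cochains_True: "c \<in> cochains (Suc n) (Suc s) N \<Longrightarrow> (\<lambda>m. c (True # m)) \<in> cochains n s N"
  by (force simp: cochains_def)

lemma cochains_map: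
  assumes "c \<in> cochains n s N" "\<And>x. x \<in> N \<Longrightarrow> f x \<in> N'" "f 0 = 0"
  shows "(\<lambda>l. f (c l)) \<in> cochains n s N'"
proof -
  have "c l \<noteq> 0" if "f (c l) \<noteq> 0" for l
    using that assms(3) by metis
  then show ?thesis
    using assms(1,2) unfolding cochains_def by blast
qed

lemma cochains_map2:
  assumes "c \<in> cochains n s N" "c' \<in> cochains n s N"
    and "\<And>x y. x \<in> N \<Longrightarrow> y \<in> N \<Longrightarrow> f x y \<in> N'" "f 0 0 = 0"
  shows "(\<lambda>l. f (c l) (c' l)) \<in> cochains n s N'"
proof -
  have "c l \<noteq> 0 \<or> c' l \<noteq> 0" if "f (c l) (c' l) \<noteq> 0" for l
    using that assms(4) by metis
  then show ?thesis
    using assms(1-3) unfolding cochains_def by blast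
qed

text \<open>Naturality of the Koszul differential under a map that is linear on a submodule \<open>N\<close>. Closure of \<open>N\<close> under the differential is part of the same induction.\<close>

lemma koszul_d_map:
  assumes c: "\<And>l. c l \<in> N"
    and f0: "f 0 = 0"
    and f_scale: "\<And>r x. r \<in> set xs \<Longrightarrow> x \<in> N \<Longrightarrow> f (scale r x) = scale' r (f x)"
    and f_diff: "\<And>x y. x \<in> N \<Longrightarrow> y \<in> N \<Longrightarrow> f (x - y) = f x - f y"
    and N0: "0 \<in> N"
    and N_scale: "\<And>r x. x \<in> N \<Longrightarrow> scale r x \<in> N"
    and N_diff: "\<And>x y. x \<in> N \<Longrightarrow> y \<in> N \<Longrightarrow> x - y \<in> N"
  shows "koszul_d scale' xs (\<lambda>l. f (c l)) l = f (koszul_d scale xs c l) \<and> koszul_d scale xs c l \<in> N"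
  using c f_scale
proof (induction xs arbitrary: c l)
  case Nil
  then show ?case by (simp add: f0 N0)
next
  case (Cons x xs)
  show ?case
  proof (cases l)
    case Nil
    then show ?thesis by (simp add: f0 N0)
  next
    case (Cons b m)
    then show ?thesis
      using Cons.IH[of "\<lambda>m. c (b # m)" m] Cons.prems
      by (cases b) (auto simp: N_scale N_diff f_diff)
  qed
qed

lemma koszul_d_replicate_False [simp]: "koszul_d scale xs c (replicate n False) = 0"
proof (induction xs arbitrary: c n)
  case (Cons x xs)
  then show ?case by (cases n) auto
qed simp

context Modules.module
begin

lemma koszul_d_zero: "koszul_d scale xs (\<lambda>_. 0) l = 0"
proof (induction xs arbitrary: l)
  case (Cons x xs)
  show ?case
  proof (cases l)
    case (Cons b m)
    then show ?thesis using Cons.IH[of m] by (cases b) auto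
  qed simp
qed simp

lemma koszul_d_add:
  "koszul_d scale xs (\<lambda>l. c l + c' l) l = koszul_d scale xs c l + koszul_d scale xs c' l"
proof (induction xs arbitrary: c c' l)
  case (Cons x xs)
  show ?case
  proof (cases l)
    case (Cons b m)
    then show ?thesis using Cons.IH[of "\<lambda>m. c (b # m)" "\<lambda>m. c' (b # m)" m]
      by (cases b) (auto simp: algebra_simps)
  qed simp
qed simp

lemma koszul_d_scale: "koszul_d scale xs (\<lambda>l. r *s c l) l = r *s koszul_d scale xs c l"
  by (rule koszul_d_map[of c UNIV "scale r" xs scale scale l, THEN conjunct1])
    (rule UNIV_I scale_zero_right scale_left_commute scale_right_diff_distrib)+

lemma koszul_d_diff:
  "koszul_d scale xs (\<lambda>l. c l - c' l) l = koszul_d scale xs c l - koszul_d scale xs c' l"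
  using koszul_d_add[of xs c "\<lambda>l. (- 1) *s c' l" l] koszul_d_scale[of xs "- 1" c' l] by simp

lemma koszul_d_minus: "koszul_d scale xs (\<lambda>l. - c l) l = - koszul_d scale xs c l"
  using koszul_d_scale[of xs "- 1" c l] by simp

lemma koszul_d_in:
  assumes "subspace N" "\<And>l. c l \<in> N"
  shows "koszul_d scale xs c l \<in> N"
  by (rule koszul_d_map[of c N id xs scale scale l, THEN conjunct2])
    (simp_all add: assms subspace_0 subspace_scale subspace_diff)

lemma koszul_d_cochains:
  assumes N: "subspace N" and c: "c \<in> cochains (length xs) s N"
  shows "koszul_d scale xs c \<in> cochains (length xs) (Suc s) N"
proof -
  have "length l = length xs \<and> count_list l True < Suc s" if "koszul_d scale xs c l \<noteq> 0" for l
    using that c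
  proof (induction xs arbitrary: c l s)
    case (Cons x xs)
    have "s \<noteq> 0"
    proof
      assume "s = 0"
      then have "c = (\<lambda>_. 0)" using Cons.prems(2) cochains_0[of c "length (x # xs)" N] by simp
      then show False using Cons.prems(1) koszul_d_zero[of "x # xs" l] by simp
    qed
    then obtain s' where s: "s = Suc s'" by (cases s) auto
    show ?case
    proof (cases l)
      case l: (Cons b m)
      show ?thesis
      proof (cases b)
        case False
        then show ?thesis
          using Cons.IH[of "\<lambda>m. c (False # m)" m s] cochains_False[of c "length xs" s N] Cons.prems l
          by simp
      next
        case True
        have "c (False # m) \<noteq> 0 \<or> koszul_d scale xs (\<lambda>m. c (True # m)) m \<noteq> 0"
          using Cons.prems True l by auto
        then show ?thesis
        proof
          assume "c (False # m) \<noteq> 0"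
          then show ?thesis using Cons.prems(2) l True by (force simp: cochains_def)
        next
          assume "koszul_d scale xs (\<lambda>m. c (True # m)) m \<noteq> 0"
          then show ?thesis
            using Cons.IH[of "\<lambda>m. c (True # m)" m s'] cochains_True[of c "length xs" s' N]
              Cons.prems l True s by simp
        qed
      qed
    qed (use Cons in auto)
  qed simp
  moreover have "koszul_d scale xs c l \<in> N" for l
    using koszul_d_in[OF N] c by (auto simp: cochains_def)
  ultimately show ?thesis by (auto simp: cochains_def)
qed

lemma koszul_d_cochains_pred:
  assumes N: "subspace N" and c: "c \<in> cochains (length xs) (s - 1) N"
  shows "koszul_d scale xs c \<in> cochains (length xs) s N"
proof (cases s)
  case 0
  then have "c = (\<lambda>_. 0)" using c cochains_0[of c "length xs" N] by simp
  then have "koszul_d scale xs c = (\<lambda>_. 0)" by (simp add: koszul_d_zero[abs_def])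
  then show ?thesis by (simp add: zero_cochain subspace_0[OF N])
next
  case (Suc t)
  then show ?thesis using koszul_d_cochains[OF N, of c xs t] c by simp
qed

lemma koszul_d_koszul_d: "koszul_d scale xs (koszul_d scale xs c) l = 0"
proof (induction xs arbitrary: c l)
  case (Cons x xs)
  show ?case
  proof (cases l)
    case (Cons b m)
    then show ?thesis
      using Cons.IH by (cases b) (auto simp: koszul_d_diff koszul_d_scale)
  qed simp
qed simp

lemma cochains_diff:
  "subspace N \<Longrightarrow> c \<in> cochains n s N \<Longrightarrow> c' \<in> cochains n s N \<Longrightarrow> (\<lambda>l. c l - c' l) \<in> cochains n s N"
  by (rule cochains_map2) (auto simp: subspace_diff)

lemma cochains_add:
  "subspace N \<Longrightarrow> c \<in> cochains n s N \<Longrightarrow> c' \<in> cochains n s N \<Longrightarrow> (\<lambda>l. c l + c' l) \<in> cochains n s N"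
  by (rule cochains_map2) (auto simp: subspace_add)

lemma cochains_scale:
  "subspace N \<Longrightarrow> c \<in> cochains n s N \<Longrightarrow> (\<lambda>l. r *s c l) \<in> cochains n s N"
  using cochains_map[of c n s N "scale r" N] by (simp add: subspace_scale)

end

section \<open>Null-homotopic multiplications\<close>

text \<open>The homotopy that contracts multiplication by the entry at position \<open>i\<close>. On the cone it sends
\<open>(a, b)\<close> to \<open>(b, 0)\<close>, and it is carried through further cones with an alternating sign.\<close>

fun koszul_h :: "nat \<Rightarrow> (bool list \<Rightarrow> 'b::ab_group_add) \<Rightarrow> bool list \<Rightarrow> 'b"
  where
    "koszul_h 0 c (False # l) = c (True # l)"
  | "koszul_h 0 c (True # l) = 0"
  | "koszul_h (Suc i) c (False # l) = koszul_h i (\<lambda>m. c (False # m)) l"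
  | "koszul_h (Suc i) c (True # l) = - koszul_h i (\<lambda>m. c (True # m)) l"
  | "koszul_h _ c [] = 0"

lemma koszul_h_zero: "koszul_h i (\<lambda>_. 0) l = 0"
proof (induction i arbitrary: l)
  case 0
  show ?case
  proof (cases l)
    case (Cons b m)
    then show ?thesis by (cases b) auto
  qed simp
next
  case (Suc i)
  show ?case
  proof (cases l)
    case (Cons b m)
    then show ?thesis using Suc[of m] by (cases b) auto
  qed simp
qed

context Modules.module
begin

lemma koszul_h_diff: "koszul_h i (\<lambda>l. c l - c' l) l = koszul_h i c l - koszul_h i c' l"
proof (induction i arbitrary: c c' l)
  case 0
  show ?case
  proof (cases l)
    case (Cons b m)
    then show ?thesis by (cases b) auto
  qed simp
next
  case (Suc i)
  show ?case
  proof (cases l)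
    case (Cons b m)
    then show ?thesis using Suc[of "\<lambda>m. c (b # m)" "\<lambda>m. c' (b # m)" m] by (cases b) auto
  qed simp
qed

lemma koszul_h_scale: "koszul_h i (\<lambda>l. r *s c l) l = r *s koszul_h i c l"
proof (induction i arbitrary: c l)
  case 0
  show ?case
  proof (cases l)
    case (Cons b m)
    then show ?thesis by (cases b) auto
  qed simp
next
  case (Suc i)
  show ?case
  proof (cases l)
    case (Cons b m)
    then show ?thesis using Suc[of "\<lambda>m. c (b # m)" m] by (cases b) auto
  qed simp
qed

lemma koszul_h_in:
  assumes "subspace N" "\<And>l. c l \<in> N"
  shows "koszul_h i c l \<in> N"
  using assms(2)
proof (induction i arbitrary: c l)
  case 0
  show ?case
  proof (cases l)
    case (Cons b m)
    then show ?thesis using 0 by (cases b) (auto simp: subspace_0[OF assms(1)])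
  qed (simp add: subspace_0[OF assms(1)])
next
  case (Suc i)
  show ?case
  proof (cases l)
    case (Cons b m)
    then show ?thesis using Suc.IH[of "\<lambda>m. c (b # m)" m] Suc.prems
      by (cases b) (auto simp: subspace_neg[OF assms(1)])
  qed (simp add: subspace_0[OF assms(1)])
qed

lemma koszul_h_cochains:
  assumes N: "subspace N" and c: "c \<in> cochains n s N"
  shows "koszul_h i c \<in> cochains n (s - 1) N"
proof -
  have "length l = n \<and> Suc (count_list l True) < s" if "koszul_h i c l \<noteq> 0" for l
    using that c
  proof (induction i arbitrary: c l n s)
    case 0
    then obtain m where "l = False # m" "c (True # m) \<noteq> 0"
      by (cases "(0::nat, c, l)" rule: koszul_h.cases) auto
    then show ?case using 0 by (auto simp: cochains_def)
  next
    case (Suc i)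
    obtain b m where l: "l = b # m" using Suc.prems by (cases l) auto
    have h: "koszul_h i (\<lambda>m. c (b # m)) m \<noteq> 0"
      using Suc.prems l by (cases b) auto
    then have "(\<lambda>m. c (b # m)) \<noteq> (\<lambda>_. 0)" using koszul_h_zero by metis
    then obtain m' where "c (b # m') \<noteq> 0" by auto
    then have "length (b # m') = n" "count_list (b # m') True < s"
      using Suc.prems(2) unfolding cochains_def by blast+
    then obtain n' s' where n: "n = Suc n'" and s: "s = Suc s'"
      by (cases s) auto
    show ?case
    proof (cases b)
      case False
      then show ?thesis
        using Suc.IH[OF h, of n' s] cochains_False[of c n' s N] Suc.prems(2) l n by simp
    next
      case True
      then show ?thesis
        using Suc.IH[OF h, of n' s'] cochains_True[of c n' s' N] Suc.prems(2) l n s by simp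
    qed
  qed
  moreover have "koszul_h i c l \<in> N" for l
    using koszul_h_in[OF N] c by (auto simp: cochains_def)
  ultimately show ?thesis by (fastforce simp: cochains_def)
qed

lemma koszul_homotopy:
  assumes "i < length xs" "length l = length xs"
  shows "koszul_d scale xs (koszul_h i c) l + koszul_h i (koszul_d scale xs c) l = (xs ! i) *s c l"
  using assms
proof (induction xs arbitrary: i c l)
  case (Cons x xs)
  obtain b m where l: "l = b # m" using Cons.prems by (cases l) auto
  show ?case
  proof (cases i)
    case 0
    then show ?thesis using l by (cases b) (auto simp: koszul_d_zero)
  next
    case (Suc j)
    have IH: "koszul_d scale xs (koszul_h j (\<lambda>m. c (b # m))) m
        + koszul_h j (koszul_d scale xs (\<lambda>m. c (b # m))) m = (xs ! j) *s c (b # m)"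
      using Cons Suc l by auto
    show ?thesis
      using l Suc IH
      by (cases b) (auto simp: koszul_d_minus koszul_h_diff koszul_h_scale algebra_simps)
  qed
qed simp

lemma set_subset_koszul_null:
  assumes N: "subspace N" and L: "subspace L"
  shows "set xs \<subseteq> koszul_null scale xs s N L"
proof
  fix x assume "x \<in> set xs"
  then obtain i where i: "i < length xs" "x = xs ! i" by (metis in_set_conv_nth)
  show "x \<in> koszul_null scale xs s N L"
    unfolding koszul_null_def
  proof (intro CollectI ballI impI)
    fix c assume c: "c \<in> cochains (length xs) s N" and dc: "\<forall>l. koszul_d scale xs c l \<in> L"
    have h: "koszul_h i c \<in> cochains (length xs) (s - 1) N" using koszul_h_cochains[OF N c] .
    have "x *s c l - koszul_d scale xs (koszul_h i c) l \<in> L" for l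
    proof (cases "length l = length xs")
      case True
      then have "x *s c l - koszul_d scale xs (koszul_h i c) l = koszul_h i (koszul_d scale xs c) l"
        using koszul_homotopy[of i xs l c] i by (simp add: algebra_simps)
      then show ?thesis using koszul_h_in[OF L] dc by simp
    next
      case False
      then have "c l = 0" "koszul_d scale xs (koszul_h i c) l = 0"
        using c koszul_d_cochains[OF N h] by (auto simp: cochains_def)
      then show ?thesis using L by (simp add: subspace_0)
    qed
    then show "\<exists>g\<in>cochains (length xs) (s - 1) N. \<forall>l. x *s c l - koszul_d scale xs g l \<in> L"
      using h by blast
  qed
qed

text \<open>Null-homotopic multiplications form an ideal, so they include every element of the ideal generated
by \<open>xs\<close>, and not only the entries of \<open>xs\<close> themselves.\<close>

lemma koszul_null_ideal:
  assumes N: "subspace N" and L: "subspace L"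
  shows "0 \<in> koszul_null scale xs s N L"
    and "\<lbrakk>f \<in> koszul_null scale xs s N L; g \<in> koszul_null scale xs s N L\<rbrakk> \<Longrightarrow> f + g \<in> koszul_null scale xs s N L"
    and "f \<in> koszul_null scale xs s N L \<Longrightarrow> r * f \<in> koszul_null scale xs s N L"
proof -
  have "\<forall>l. 0 *s c l - koszul_d scale xs (\<lambda>_. 0) l \<in> L" for c
    by (simp add: koszul_d_zero subspace_0[OF L])
  then show "0 \<in> koszul_null scale xs s N L"
    unfolding koszul_null_def using zero_cochain[OF subspace_0[OF N]] by blast
next
  assume f: "f \<in> koszul_null scale xs s N L" and g: "g \<in> koszul_null scale xs s N L"
  show "f + g \<in> koszul_null scale xs s N L"
    unfolding koszul_null_def
  proof (intro CollectI ballI impI)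
    fix c assume c: "c \<in> cochains (length xs) s N" "\<forall>l. koszul_d scale xs c l \<in> L"
    obtain u v where u: "u \<in> cochains (length xs) (s - 1) N" "\<forall>l. f *s c l - koszul_d scale xs u l \<in> L"
      and v: "v \<in> cochains (length xs) (s - 1) N" "\<forall>l. g *s c l - koszul_d scale xs v l \<in> L"
      using f g c unfolding koszul_null_def by blast
    have "(f + g) *s c l - koszul_d scale xs (\<lambda>l. u l + v l) l \<in> L" for l
      using subspace_add[OF L u(2)[rule_format] v(2)[rule_format], of l l]
      by (simp add: koszul_d_add algebra_simps)
    then show "\<exists>w\<in>cochains (length xs) (s - 1) N. \<forall>l. (f + g) *s c l - koszul_d scale xs w l \<in> L"
      using cochains_add[OF N u(1) v(1)] by blast
  qed
next
  assume f: "f \<in> koszul_null scale xs s N L"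
  show "r * f \<in> koszul_null scale xs s N L"
    unfolding koszul_null_def
  proof (intro CollectI ballI impI)
    fix c assume c: "c \<in> cochains (length xs) s N" "\<forall>l. koszul_d scale xs c l \<in> L"
    obtain u where u: "u \<in> cochains (length xs) (s - 1) N" "\<forall>l. f *s c l - koszul_d scale xs u l \<in> L"
      using f c unfolding koszul_null_def by blast
    have "(r * f) *s c l - koszul_d scale xs (\<lambda>l. r *s u l) l \<in> L" for l
      using subspace_scale[OF L u(2)[rule_format], of r l]
      by (simp add: koszul_d_scale scale_right_diff_distrib)
    then show "\<exists>w\<in>cochains (length xs) (s - 1) N. \<forall>l. (r * f) *s c l - koszul_d scale xs w l \<in> L"
      using cochains_scale[OF N u(1)] by blast
  qed
qed

section \<open>Vanishing of Koszul cohomology\<close>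

lemma koszul_acyclic_0:
  assumes N: "subspace N" and L: "subspace L"
  shows "koszul_acyclic scale xs 0 N L"
  unfolding koszul_acyclic_def
proof (intro ballI impI)
  fix c assume "c \<in> cochains (length xs) 0 N"
  then have "c = (\<lambda>_. 0)" by (rule cochains_0)
  then have "\<forall>l. c l - koszul_d scale xs (\<lambda>_. 0) l \<in> L"
    by (simp add: koszul_d_zero subspace_0[OF L])
  then show "\<exists>v\<in>cochains (length xs) (0 - 1) N. \<forall>l. c l - koszul_d scale xs v l \<in> L"
    using zero_cochain[OF subspace_0[OF N]] by blast
qed

text \<open>Rees's argument: in the long exact sequence of \<open>0 \<rightarrow> N \<rightarrow> N \<rightarrow> N/fN \<rightarrow> 0\<close>, where \<open>N\<close> stands for the
ambient module modulo \<open>L\<close>, vanishing for \<open>N/fN\<close> in degrees below \<open>s - 1\<close> makes \<open>f\<close> injective on the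
cohomology of \<open>N\<close> in degrees below \<open>s\<close>; but \<open>f\<close> is zero there, so this cohomology vanishes. In the
proof, \<open>f c\<close> is the boundary of some \<open>g\<close>, and \<open>g\<close> can be corrected by a boundary so that it becomes
divisible by \<open>f\<close>.\<close>

lemma koszul_acyclic_regular_step:
  assumes L: "subspace L"
    and L': "\<And>x. x \<in> L' \<longleftrightarrow> (\<exists>y\<in>L. \<exists>z. x = y + f *s z)"
    and f: "f \<in> koszul_null scale xs s UNIV L"
    and reg: "\<And>z. f *s z \<in> L \<Longrightarrow> z \<in> L"
    and ac: "koszul_acyclic scale xs (s - 1) UNIV L'"
  shows "koszul_acyclic scale xs s UNIV L"
  unfolding koszul_acyclic_def
proof (intro ballI impI)
  let ?n = "length xs"
  fix c assume c: "c \<in> cochains ?n s UNIV" and dc: "\<forall>l. koszul_d scale xs c l \<in> L"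
  obtain g where g: "g \<in> cochains ?n (s - 1) UNIV" "\<forall>l. f *s c l - koszul_d scale xs g l \<in> L"
    using f c dc unfolding koszul_null_def by blast
  have "koszul_d scale xs g l \<in> L'" for l
  proof -
    have "koszul_d scale xs g l = - (f *s c l - koszul_d scale xs g l) + f *s c l" by simp
    then show ?thesis using subspace_neg[OF L g(2)[rule_format]] L' by blast
  qed
  then obtain g' where g': "g' \<in> cochains ?n (s - 1 - 1) UNIV" "\<forall>l. g l - koszul_d scale xs g' l \<in> L'"
    using ac g unfolding koszul_acyclic_def by blast
  have dg': "koszul_d scale xs g' \<in> cochains ?n (s - 1) UNIV"
    by (rule koszul_d_cochains_pred[OF subspace_UNIV g'(1)])
  define e where "e l = g l - koszul_d scale xs g' l" for l
  have e: "e \<in> cochains ?n (s - 1) UNIV"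
    unfolding e_def[abs_def] by (rule cochains_diff[OF _ g(1) dg']) simp
  \<comment> \<open>After the correction by \<open>g'\<close>, the cochain \<open>g\<close> is divisible by \<open>f\<close> modulo \<open>L\<close>.\<close>
  have "\<exists>z. e l - f *s z \<in> L" for l
  proof -
    obtain y z where "y \<in> L" "e l = y + f *s z"
      using g'(2) unfolding L' e_def by blast
    then have "e l - f *s z \<in> L" by simp
    then show ?thesis ..
  qed
  then obtain z where z: "\<And>l. e l - f *s z l \<in> L" by metis
  \<comment> \<open>Quotients at zero entries are set to zero, so that \<open>v\<close> stays in the filtration step of \<open>e\<close>.\<close>
  define v where "v l = (if e l = 0 then 0 else z l)" for l
  have v: "v \<in> cochains ?n (s - 1) UNIV" using e by (auto simp: cochains_def v_def)
  have ev: "e l - f *s v l \<in> L" for l using z[of l] L by (auto simp: v_def subspace_0)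
  have "c l - koszul_d scale xs v l \<in> L" for l
  proof (rule reg)
    have "koszul_d scale xs (\<lambda>l. e l - f *s v l) l \<in> L"
      by (rule koszul_d_in[OF L]) (rule ev)
    moreover have "koszul_d scale xs (\<lambda>l. e l - f *s v l) l
        = koszul_d scale xs g l - f *s koszul_d scale xs v l"
      by (simp add: koszul_d_diff koszul_d_scale e_def[abs_def] koszul_d_koszul_d)
    ultimately have "koszul_d scale xs g l - f *s koszul_d scale xs v l \<in> L" by simp
    from subspace_add[OF L g(2)[rule_format, of l] this]
    show "f *s (c l - koszul_d scale xs v l) \<in> L" by (simp add: scale_right_diff_distrib)
  qed
  then show "\<exists>v\<in>cochains ?n (s - 1) UNIV. \<forall>l. c l - koszul_d scale xs v l \<in> L" using v by blast
qed

text \<open>The depth lemma for \<open>0 \<rightarrow> K \<rightarrow> Q \<rightarrow> Q/K \<rightarrow> 0\<close>: the differential of a cocycle modulo \<open>K\<close> is a cocycle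
in \<open>K\<close> of one degree more, hence the boundary of a cochain in \<open>K\<close>, which can be subtracted.\<close>

lemma koszul_acyclic_quotient:
  assumes Q: "subspace Q" and K: "subspace K" "K \<subseteq> Q"
    and acQ: "koszul_acyclic scale xs s Q {0}" and acK: "koszul_acyclic scale xs (Suc s) K {0}"
  shows "koszul_acyclic scale xs s Q K"
  unfolding koszul_acyclic_def
proof (intro ballI impI)
  let ?n = "length xs"
  fix c assume c: "c \<in> cochains ?n s Q" and dc: "\<forall>l. koszul_d scale xs c l \<in> K"
  have "koszul_d scale xs c \<in> cochains ?n (Suc s) K"
    using koszul_d_cochains[OF Q c] dc by (auto simp: cochains_def)
  then obtain k where k: "k \<in> cochains ?n s K" "\<And>l. koszul_d scale xs c l = koszul_d scale xs k l"
    using acK koszul_d_koszul_d unfolding koszul_acyclic_def by fastforce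
  have "(\<lambda>l. c l - k l) \<in> cochains ?n s Q"
    using cochains_diff[OF Q c cochains_mono[OF k(1)]] K by simp
  moreover have "\<forall>l. koszul_d scale xs (\<lambda>l. c l - k l) l \<in> {0}"
    by (simp add: koszul_d_diff k(2))
  ultimately obtain v where v: "v \<in> cochains ?n (s - 1) Q"
    "\<forall>l. c l - k l - koszul_d scale xs v l \<in> {0}"
    using acQ unfolding koszul_acyclic_def by blast
  have cv: "c l - koszul_d scale xs v l = k l" for l using v(2) by (simp add: algebra_simps)
  show "\<exists>v\<in>cochains ?n (s - 1) Q. \<forall>l. c l - koszul_d scale xs v l \<in> K"
  proof (intro bexI[OF _ v(1)] allI)
    fix l
    show "c l - koszul_d scale xs v l \<in> K"
      unfolding cv using k(1) by (simp add: cochains_def)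
  qed
qed

text \<open>Transport along the isomorphism \<open>Q / ker f \<cong> f(Q)\<close>, for a map \<open>f\<close> that is linear on \<open>Q\<close> only.\<close>

lemma koszul_acyclic_image:
  assumes Q: "subspace Q"
    and f_diff: "\<And>x y. x \<in> Q \<Longrightarrow> y \<in> Q \<Longrightarrow> f (x - y) = f x - f y"
    and f_scale: "\<And>r x. x \<in> Q \<Longrightarrow> f (r *s x) = r *s f x"
    and ac: "koszul_acyclic scale xs s Q {x \<in> Q. f x = 0}"
  shows "koszul_acyclic scale xs s (f ` Q) {0}"
  unfolding koszul_acyclic_def
proof (intro ballI impI)
  let ?n = "length xs"
  fix c assume c: "c \<in> cochains ?n s (f ` Q)" and dc: "\<forall>l. koszul_d scale xs c l \<in> {0}"
  have f0: "f 0 = 0" using f_diff[of 0 0] subspace_0[OF Q] by simp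
  have "\<forall>l. \<exists>x\<in>Q. f x = c l \<and> (c l = 0 \<longrightarrow> x = 0)"
  proof
    fix l
    have "c l \<in> f ` Q" using c by (simp add: cochains_def)
    then show "\<exists>x\<in>Q. f x = c l \<and> (c l = 0 \<longrightarrow> x = 0)"
      using f0 subspace_0[OF Q] by (cases "c l = 0") auto
  qed
  then obtain e where e: "\<And>l. e l \<in> Q" "\<And>l. f (e l) = c l" "\<And>l. c l = 0 \<Longrightarrow> e l = 0"
    by metis
  have "c l \<noteq> 0" if "e l \<noteq> 0" for l using e(3) that by blast
  then have eQ: "e \<in> cochains ?n s Q" using c e(1) unfolding cochains_def by blast
  have map: "koszul_d scale xs (\<lambda>l. f (w l)) l = f (koszul_d scale xs w l) \<and> koszul_d scale xs w l \<in> Q"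
    if "\<And>l. w l \<in> Q" for w l
    by (rule koszul_d_map)
      (use that f0 f_diff f_scale subspace_0[OF Q] subspace_scale[OF Q] subspace_diff[OF Q] in blast)+
  have "koszul_d scale xs e l \<in> {x \<in> Q. f x = 0}" for l
    using map[of e l] e dc by simp
  then obtain v where v: "v \<in> cochains ?n (s - 1) Q"
    "\<And>l. e l - koszul_d scale xs v l \<in> {x \<in> Q. f x = 0}"
    using ac eQ unfolding koszul_acyclic_def by blast
  have vQ: "v l \<in> Q" for l using v(1) by (simp add: cochains_def)
  have "c l - koszul_d scale xs (\<lambda>l. f (v l)) l = 0" for l
    using v(2)[of l] map[of v l] vQ e f_diff[of "e l" "koszul_d scale xs v l"] by auto
  moreover have "(\<lambda>l. f (v l)) \<in> cochains ?n (s - 1) (f ` Q)"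
    using cochains_map[OF v(1)] f0 by blast
  ultimately show "\<exists>v\<in>cochains ?n (s - 1) (f ` Q). \<forall>l. c l - koszul_d scale xs v l \<in> {0}"
    by blast
qed

text \<open>Exactness for \<open>z # xs\<close> makes \<open>z\<close> surjective on the cohomology for \<open>xs\<close> one degree lower. The maps
\<open>\<tau> k\<close> stand for truncation to the part of \<open>z\<close>-degree below \<open>k\<close>, in a module graded by \<open>z\<close>-degree such
that \<open>xs\<close> preserves the degree. A graded form of Nakayama's lemma then applies: writing a cocycle
repeatedly as \<open>z\<close> times a cocycle plus a boundary shows that every truncation of it is a boundary,
and a large enough truncation is the cocycle itself.\<close>

lemma koszul_acyclic_cone_step:
  assumes I: "subspace I"
    and ac: "koszul_acyclic scale (z # xs) (Suc s) UNIV I"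
    and t_diff: "\<And>k x y. \<tau> k (x - y) = \<tau> k x - \<tau> k y"
    and t_scale: "\<And>k r x. r \<in> set xs \<Longrightarrow> \<tau> k (r *s x) = r *s \<tau> k x"
    and t_0: "\<And>x. \<tau> 0 x = 0"
    and t_Suc: "\<And>k x. \<tau> (Suc k) (z *s x) = z *s \<tau> k x"
    and t_I: "\<And>k x. x \<in> I \<Longrightarrow> \<tau> k x \<in> I"
    and t_ev: "\<And>x. \<exists>k0. \<forall>k\<ge>k0. \<tau> k x = x"
  shows "koszul_acyclic scale xs s UNIV I"
  unfolding koszul_acyclic_def
proof (intro ballI impI)
  let ?n = "length xs"
  have t_zero: "\<tau> k 0 = 0" for k using t_diff[of k 0 0] by simp
  have t_minus: "\<tau> k (- x) = - \<tau> k x" for k x using t_diff[of k 0 x] t_zero by simp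
  have t_add: "\<tau> k (x + y) = \<tau> k x + \<tau> k y" for k x y
    using t_diff[of k x "- y"] t_minus by simp
  have t_d: "koszul_d scale xs (\<lambda>l. \<tau> k (w l)) l = \<tau> k (koszul_d scale xs w l)" for k w l
    by (rule koszul_d_map[of w UNIV "\<tau> k" xs scale scale l, THEN conjunct1])
      (simp_all only: UNIV_I t_zero t_diff t_scale)
  \<comment> \<open>The surjectivity of \<open>z\<close> is read off the cone by feeding it the cochain \<open>(0, c)\<close>.\<close>
  have split: "\<exists>a\<in>cochains ?n s UNIV. \<exists>b\<in>cochains ?n (s - 1) UNIV.
      (\<forall>l. koszul_d scale xs a l \<in> I) \<and> (\<forall>l. c l - (z *s a l + koszul_d scale xs b l) \<in> I)"
    if c: "c \<in> cochains ?n s UNIV" and dc: "\<forall>l. koszul_d scale xs c l \<in> I" for c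
  proof -
    define c' where "c' l = (case l of True # m \<Rightarrow> c m | _ \<Rightarrow> 0)" for l
    have c'_simps: "c' (True # m) = c m" "c' (False # m) = 0" "c' [] = 0" for m
      by (auto simp: c'_def)
    have "c' \<in> cochains n' (Suc s) UNIV" if "n' = Suc ?n" for n'
      unfolding cochains_def
    proof (intro CollectI allI conjI impI)
      fix l assume "c' l \<noteq> 0"
      then obtain m where "l = True # m" "c m \<noteq> 0"
        by (auto simp: c'_def split: list.splits bool.splits)
      then show "length l = n'" "count_list l True < Suc s"
        using c that by (auto simp: cochains_def)
    qed simp
    then have c': "c' \<in> cochains (length (z # xs)) (Suc s) UNIV" by simp
    have "koszul_d scale (z # xs) c' l \<in> I" for l
    proof (cases l)
      case (Cons b m)
      then show ?thesis using dc subspace_0[OF I] subspace_neg[OF I]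
        by (cases b) (auto simp: c'_simps koszul_d_zero)
    qed (simp add: subspace_0[OF I])
    then obtain v where v: "v \<in> cochains (length (z # xs)) s UNIV"
      "\<And>l. c' l - koszul_d scale (z # xs) v l \<in> I"
      using ac c' unfolding koszul_acyclic_def by auto
    define a where "a m = v (False # m)" for m
    define b where "b m = - v (True # m)" for m
    have a: "a \<in> cochains ?n s UNIV" unfolding a_def[abs_def] using v(1) cochains_False by auto
    have b: "b \<in> cochains ?n (s - 1) UNIV"
    proof (cases s)
      case 0
      then have "v = (\<lambda>_. 0)" using v(1) cochains_0 by blast
      then show ?thesis by (auto simp: cochains_def b_def)
    next
      case (Suc s')
      then show ?thesis
        using v(1) cochains_map[OF cochains_True[of v ?n s' UNIV], of uminus UNIV]
        by (simp add: b_def[abs_def])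
    qed
    have "koszul_d scale xs a l \<in> I" for l
      using subspace_neg[OF I v(2)[of "False # l"]] by (simp add: c'_simps a_def[abs_def])
    moreover have "c l - (z *s a l + koszul_d scale xs b l) \<in> I" for l
      using v(2)[of "True # l"] by (simp add: c'_simps a_def b_def[abs_def] koszul_d_minus)
    ultimately show ?thesis using a b by blast
  qed
  have trunc: "\<exists>v\<in>cochains ?n (s - 1) UNIV. \<forall>l. \<tau> k (c l) - koszul_d scale xs v l \<in> I"
    if "c \<in> cochains ?n s UNIV" "\<forall>l. koszul_d scale xs c l \<in> I" for k c
    using that
  proof (induction k arbitrary: c)
    case 0
    have "\<forall>l. \<tau> 0 (c l) - koszul_d scale xs (\<lambda>_. 0) l \<in> I"
      by (simp add: t_0 koszul_d_zero subspace_0[OF I])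
    then show ?case using zero_cochain[of UNIV] by blast
  next
    case (Suc k)
    obtain a b where a: "a \<in> cochains ?n s UNIV" "\<forall>l. koszul_d scale xs a l \<in> I"
      and b: "b \<in> cochains ?n (s - 1) UNIV"
      and ab: "\<And>l. c l - (z *s a l + koszul_d scale xs b l) \<in> I"
      using split[OF Suc.prems] by blast
    obtain w where w: "w \<in> cochains ?n (s - 1) UNIV"
      "\<And>l. \<tau> k (a l) - koszul_d scale xs w l \<in> I" using Suc.IH[OF a] by blast
    define v where "v l = z *s w l + \<tau> (Suc k) (b l)" for l
    have v: "v \<in> cochains ?n (s - 1) UNIV" unfolding v_def[abs_def]
      by (intro cochains_add cochains_scale w(1) cochains_map[OF b] subspace_UNIV UNIV_I t_zero)
    have "\<tau> (Suc k) (c l) - koszul_d scale xs v l \<in> I" for l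
    proof -
      have "\<tau> (Suc k) (c l - (z *s a l + koszul_d scale xs b l)) + z *s (\<tau> k (a l) - koszul_d scale xs w l) \<in> I"
        using subspace_add[OF I t_I[OF ab] subspace_scale[OF I w(2)]] .
      then show ?thesis
        by (simp add: v_def[abs_def] koszul_d_add koszul_d_scale t_d t_diff t_add t_Suc algebra_simps)
    qed
    then show ?case using v by blast
  qed
  fix c assume c: "c \<in> cochains ?n s UNIV" "\<forall>l. koszul_d scale xs c l \<in> I"
  have fin: "finite {l :: bool list. length l = ?n}"
    using finite_lists_length_eq[of "UNIV :: bool set" ?n] by simp
  obtain k0 where k0: "\<And>x k. k0 x \<le> k \<Longrightarrow> \<tau> k x = x" using t_ev by metis
  define k where "k = Max ((\<lambda>l. k0 (c l)) ` {l. length l = ?n})"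
  have "\<tau> k (c l) = c l" for l
  proof (cases "length l = ?n")
    case True
    then show ?thesis using fin by (intro k0) (auto simp: k_def)
  next
    case False
    then have "c l = 0" using c(1) by (auto simp: cochains_def)
    then show ?thesis by (simp add: t_zero)
  qed
  then show "\<exists>v\<in>cochains ?n (s - 1) UNIV. \<forall>l. c l - koszul_d scale xs v l \<in> I"
    using trunc[OF c, of k] by simp
qed

text \<open>Vanishing in degree \<open>0\<close> says that no nonzero element is killed by \<open>xs\<close>, since there are no
boundaries in degree \<open>0\<close>.\<close>

lemma koszul_acyclic_1_D:
  assumes ac: "koszul_acyclic scale xs 1 N L" and N: "subspace N" and L: "subspace L"
    and x: "x \<in> N" "\<And>r. r \<in> set xs \<Longrightarrow> r *s x \<in> L"
  shows "x \<in> L"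
proof -
  define c where "c n l = (if l = replicate n False then x else 0)" for n :: nat and l
  have c: "c (length xs) \<in> cochains (length xs) 1 N"
    using x(1) by (auto simp: cochains_def c_def subspace_0[OF N] count_list_0_iff)
  have "koszul_d scale xs (c (length xs)) l \<in> L" for l
    using x(2)
  proof (induction xs arbitrary: l)
    case Nil
    then show ?case by (simp add: subspace_0[OF L])
  next
    case (Cons y xs)
    have c_Cons: "(\<lambda>m. c (length (y # xs)) (False # m)) = c (length xs)"
      "(\<lambda>m. c (length (y # xs)) (True # m)) = (\<lambda>_. 0)"
      by (auto simp: c_def)
    show ?case
    proof (cases l)
      case Nil
      then show ?thesis by (simp add: subspace_0[OF L])
    next
      case l: (Cons b m)
      have "y *s c (length xs) m \<in> L" using Cons.prems by (simp add: c_def subspace_0[OF L])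
      then show ?thesis using Cons.IH[of m] Cons.prems c_Cons l
        by (cases b) (simp_all add: koszul_d_zero c_def)
    qed
  qed
  then obtain v where "\<And>l. c (length xs) l - koszul_d scale xs v l \<in> L"
    using ac c unfolding koszul_acyclic_def by blast
  then have "c (length xs) (replicate (length xs) False) \<in> L"
    by (metis koszul_d_replicate_False diff_zero)
  then show ?thesis by (simp add: c_def)
qed

end

lemma module_times: "Modules.module ((*) :: 'a::comm_ring_1 \<Rightarrow> 'a \<Rightarrow> 'a)"
  by unfold_locales (simp_all add: algebra_simps)

lemma subspace_times_iff:
  "Modules.module.subspace ((*) :: 'a::comm_ring_1 \<Rightarrow> 'a \<Rightarrow> 'a) J \<longleftrightarrow>
     0 \<in> J \<and> (\<forall>x\<in>J. \<forall>y\<in>J. x + y \<in> J) \<and> (\<forall>c. \<forall>x\<in>J. c * x \<in> J)"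
  by (rule Modules.module.subspace_def[OF module_times])

text \<open>Ideals of the ring record of a commutative ring type are the submodules of the regular module; this
connects the ideals generated in that record with the Koszul complex.\<close>

lemma ideal_ring_of_type_algebra_iff:
  "ideal J (ring_of_type_algebra :: 'a::comm_ring_1 ring) \<longleftrightarrow>
     Modules.module.subspace ((*) :: 'a \<Rightarrow> 'a \<Rightarrow> 'a) J"
proof
  let ?R = "ring_of_type_algebra :: 'a ring"
  interpret T: Modules.module "(*) :: 'a \<Rightarrow> 'a \<Rightarrow> 'a" by (rule module_times)
  interpret R: cring ?R by (rule cring_from_type_algebra)
  have [simp]: "\<zero>\<^bsub>?R\<^esub> = 0" "add ?R = (+)" "monoid.mult ?R = (*)" "carrier ?R = UNIV"
    by (auto simp: ring_of_type_algebra_def)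
  {
    assume "ideal J ?R"
    then interpret J: ideal J ?R .
    show "T.subspace J"
      using J.zero_closed J.a_closed J.I_l_closed by (auto intro!: T.subspaceI)
  next
    assume J: "T.subspace J"
    have inv: "inv\<^bsub>add_monoid ?R\<^esub> x = - x" for x
    proof -
      have "a_inv ?R x = - x"
        using R.minus_equality[of "- x" x] by simp
      then show ?thesis by (simp add: a_inv_def)
    qed
    show "ideal J ?R"
    proof (rule idealI)
      show "subgroup J (add_monoid ?R)"
      proof
        show "inv\<^bsub>add_monoid ?R\<^esub> x \<in> J" if "x \<in> J" for x
          unfolding inv using that by (rule T.subspace_neg[OF J])
      qed (use J in \<open>auto simp: T.subspace_0 T.subspace_add\<close>)
      show "a \<otimes>\<^bsub>?R\<^esub> x \<in> J" if "a \<in> J" for a x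
        using T.subspace_scale[OF J that, of x] by (simp add: mult.commute)
    qed (use J in \<open>auto simp: T.subspace_scale R.ring_axioms\<close>)
  }
qed

section \<open>Monomial ideals\<close>

text \<open>For \<open>up_closed U\<close> this is the ideal spanned by the monomials with exponent in \<open>U\<close>.\<close>

definition monomial_ideal :: "('n::finite \<Rightarrow>\<^sub>0 nat) set \<Rightarrow> ('n, 'k::field) mpoly set"
  where "monomial_ideal U = {p. Poly_Mapping.keys p \<subseteq> U}"

definition up_closed :: "('n::finite \<Rightarrow>\<^sub>0 nat) set \<Rightarrow> bool"
  where "up_closed U \<longleftrightarrow> (\<forall>e\<in>U. \<forall>d. e + d \<in> U)"

lemma subspace_monomial_ideal:
  assumes "up_closed U"
  shows "Modules.module.subspace (*) (monomial_ideal U :: ('n::finite, 'k::field) mpoly set)"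
  unfolding subspace_times_iff
proof (intro conjI ballI allI)
  fix p q :: "('n, 'k) mpoly"
  assume p: "p \<in> monomial_ideal U" 
  show "p + q \<in> monomial_ideal U" if "q \<in> monomial_ideal U"
    using p that Poly_Mapping.keys_add[of p q] by (auto simp: monomial_ideal_def)
  show "q * p \<in> monomial_ideal U"
    using p Poly_Mapping.keys_mult[of q p] assms
    by (fastforce simp: monomial_ideal_def up_closed_def add.commute)
qed (simp add: monomial_ideal_def)

lemma lookup_single_mult:
  fixes p :: "('a::cancel_comm_monoid_add) \<Rightarrow>\<^sub>0 ('b::comm_semiring_1)"
  shows "Poly_Mapping.lookup (Poly_Mapping.single a c * p) (a + e) = c * Poly_Mapping.lookup p e"
    and "(\<And>d. k \<noteq> a + d) \<Longrightarrow> Poly_Mapping.lookup (Poly_Mapping.single a c * p) k = 0"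
proof -
  have *: "Poly_Mapping.lookup (Poly_Mapping.single a c * p) k =
      c * (\<Sum>q. Poly_Mapping.lookup p q when k = a + q)" for k
  proof -
    have "Poly_Mapping.lookup (Poly_Mapping.single a c * p) k =
      (\<Sum>l. (c * (\<Sum>q. Poly_Mapping.lookup p q when k = l + q) when l = a))"
      unfolding lookup_mult
      by (rule Sum_any.cong) (auto simp: lookup_single when_def)
    then show ?thesis by simp
  qed
  have "(\<Sum>q. Poly_Mapping.lookup p q when a + e = a + q) = Poly_Mapping.lookup p e"
    by simp
  then show "Poly_Mapping.lookup (Poly_Mapping.single a c * p) (a + e) = c * Poly_Mapping.lookup p e"
    using * by simp
  show "Poly_Mapping.lookup (Poly_Mapping.single a c * p) k = 0" if "\<And>d. k \<noteq> a + d"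
    using that * by simp
qed

lemma lookup_mvar_mult:
  fixes p :: "('n::finite, 'k::field) mpoly"
  shows "Poly_Mapping.lookup (mvar j * p) (Poly_Mapping.single j 1 + e) = Poly_Mapping.lookup p e"
    and "Poly_Mapping.lookup k j = 0 \<Longrightarrow> Poly_Mapping.lookup (mvar j * p) k = 0"
proof -
  show "Poly_Mapping.lookup (mvar j * p) (Poly_Mapping.single j 1 + e) = Poly_Mapping.lookup p e"
    unfolding mvar_def lookup_single_mult by simp
  assume "Poly_Mapping.lookup k j = 0"
  then have "k \<noteq> Poly_Mapping.single j 1 + d" for d by (auto simp: lookup_add)
  then show "Poly_Mapping.lookup (mvar j * p) k = 0"
    unfolding mvar_def by (rule lookup_single_mult)
qed

lemma exponent_split:
  fixes e :: "'n \<Rightarrow>\<^sub>0 nat"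
  assumes "Poly_Mapping.lookup d \<le> Poly_Mapping.lookup e"
  obtains e' where "e = d + e'"
proof -
  have "e = d + (e - d)"
    using assms by (intro poly_mapping_eqI) (simp add: lookup_add lookup_minus le_fun_def)
  then show ?thesis using that by blast
qed

lemma exponent_split_single:
  fixes e :: "'n \<Rightarrow>\<^sub>0 nat"
  assumes "Poly_Mapping.lookup e j > 0"
  obtains e' where "e = Poly_Mapping.single j 1 + e'"
  by (rule exponent_split[of "Poly_Mapping.single j 1" e])
    (use assms in \<open>auto simp: le_fun_def lookup_single when_def\<close>)

lift_definition restrict_keys :: "('a \<Rightarrow> bool) \<Rightarrow> ('a \<Rightarrow>\<^sub>0 'b::zero) \<Rightarrow> ('a \<Rightarrow>\<^sub>0 'b)"
  is "\<lambda>P f k. if P k then f k else 0"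
  by (erule finite_subset[rotated]) auto

lemma restrict_keys_in_monomial_ideal: "p \<in> monomial_ideal U \<Longrightarrow> restrict_keys P p \<in> monomial_ideal U"
  unfolding monomial_ideal_def by (auto simp: in_keys_iff restrict_keys.rep_eq split: if_splits)

lemma restrict_keys_mvar_mult:
  assumes "\<And>e. P (Poly_Mapping.single j 1 + e) \<longleftrightarrow> Q e"
  shows "restrict_keys P (mvar j * p) = mvar j * restrict_keys Q p"
proof (rule poly_mapping_eqI)
  fix k
  show "Poly_Mapping.lookup (restrict_keys P (mvar j * p)) k = Poly_Mapping.lookup (mvar j * restrict_keys Q p) k"
  proof (cases "Poly_Mapping.lookup k j = 0")
    case True
    then show ?thesis by (simp add: restrict_keys.rep_eq lookup_mvar_mult(2))
  next
    case False
    then obtain e where "k = Poly_Mapping.single j 1 + e" using exponent_split_single[of k j] by blast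
    then show ?thesis using assms[of e]
      by (simp only: restrict_keys.rep_eq lookup_mvar_mult(1))
  qed
qed

text \<open>A monomial ideal is homogeneous for the degree in any single variable, so the quotient by it is
graded by \<open>z\<close>-degree and the truncations that the cone step asks for exist.\<close>

lemma koszul_acyclic_drop_variable:
  assumes U: "up_closed U" and z: "z \<notin> set vs"
    and ac: "koszul_acyclic (*) (map mvar (z # vs)) (Suc s) UNIV
      (monomial_ideal U :: ('n::finite, 'k::field) mpoly set)"
  shows "koszul_acyclic (*) (map mvar vs) s UNIV (monomial_ideal U :: ('n, 'k) mpoly set)"
proof -
  interpret T: Modules.module "(*) :: ('n, 'k) mpoly \<Rightarrow> ('n, 'k) mpoly \<Rightarrow> ('n, 'k) mpoly"
    by (rule module_times)
  define \<tau> :: "nat \<Rightarrow> ('n, 'k) mpoly \<Rightarrow> ('n, 'k) mpoly"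
    where "\<tau> k = restrict_keys (\<lambda>e. Poly_Mapping.lookup e z < k)" for k
  show ?thesis
  proof (rule T.koszul_acyclic_cone_step[where z = "mvar z" and \<tau> = \<tau>])
    show "T.subspace (monomial_ideal U)" by (rule subspace_monomial_ideal[OF U])
    show "koszul_acyclic (*) (mvar z # map mvar vs) (Suc s) UNIV (monomial_ideal U :: ('n, 'k) mpoly set)"
      using ac by simp
    show "\<tau> k (x - y) = \<tau> k x - \<tau> k y" for k x y
      by (rule poly_mapping_eqI) (simp add: \<tau>_def restrict_keys.rep_eq lookup_minus)
    show "\<tau> k (r * x) = r * \<tau> k x" if "r \<in> set (map mvar vs)" for k r x
    proof -
      obtain j where "r = mvar j" "j \<noteq> z" using \<open>r \<in> _\<close> z by auto
      then show ?thesis unfolding \<tau>_def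
        by (simp only:) (rule restrict_keys_mvar_mult, simp add: lookup_add lookup_single)
    qed
    show "\<tau> 0 x = 0" for x
      by (rule poly_mapping_eqI) (simp add: \<tau>_def restrict_keys.rep_eq)
    show "\<tau> (Suc k) (mvar z * x) = mvar z * \<tau> k x" for k x
      unfolding \<tau>_def by (rule restrict_keys_mvar_mult) (simp add: lookup_add lookup_single)
    show "\<tau> k x \<in> monomial_ideal U" if "x \<in> monomial_ideal U" for k x
      unfolding \<tau>_def by (rule restrict_keys_in_monomial_ideal[OF that])
    show "\<exists>k0. \<forall>k\<ge>k0. \<tau> k x = x" for x
    proof -
      \<comment> \<open>The entry \<open>0\<close> covers the zero polynomial, which has no keys.\<close>
      define k0 where "k0 = Suc (Max (insert 0 ((\<lambda>e. Poly_Mapping.lookup e z) ` Poly_Mapping.keys x)))"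
      have "Poly_Mapping.lookup e z < k0" if "e \<in> Poly_Mapping.keys x" for e
        unfolding k0_def using that by (simp add: less_Suc_eq_le)
      then have "\<tau> k x = x" if "k \<ge> k0" for k
        using that unfolding \<tau>_def
        by (intro poly_mapping_eqI) (force simp: restrict_keys.rep_eq in_keys_iff)
      then show ?thesis by blast
    qed
  qed
qed

lemma koszul_acyclic_drop_variables:
  assumes U: "up_closed U"
  shows "distinct (zs @ vs) \<Longrightarrow>
    koszul_acyclic (*) (map mvar (zs @ vs)) (length zs + s) UNIV
      (monomial_ideal U :: ('n::finite, 'k::field) mpoly set) \<Longrightarrow>
    koszul_acyclic (*) (map mvar vs) s UNIV (monomial_ideal U :: ('n, 'k) mpoly set)"
proof (induction zs)
  case (Cons z zs)
  have "koszul_acyclic (*) (map mvar (zs @ vs)) (length zs + s) UNIV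
      (monomial_ideal U :: ('n, 'k) mpoly set)"
    by (rule koszul_acyclic_drop_variable[OF U, of z]) (use Cons.prems in simp_all)
  then show ?case using Cons.IH Cons.prems(1) by simp
qed simp

text \<open>Distinct variables form a regular sequence: modulo the first \<open>i\<close> of them, the polynomials that
vanish are those all of whose monomials involve one of these variables, and multiplication by
another variable does not change whether a monomial does.\<close>

lemma koszul_acyclic_variables:
  fixes vs :: "'n::finite list"
  assumes vs: "distinct vs" and s: "s \<le> length vs"
  shows "koszul_acyclic (*) (map mvar vs) s UNIV {0 :: ('n, 'k::field) mpoly}"
proof -
  interpret T: Modules.module "(*) :: ('n, 'k) mpoly \<Rightarrow> ('n, 'k) mpoly \<Rightarrow> ('n, 'k) mpoly"
    by (rule module_times)
  define U where "U i = {e :: 'n \<Rightarrow>\<^sub>0 nat. \<exists>j\<in>set (take i vs). Poly_Mapping.lookup e j > 0}" for i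
  have sub: "T.subspace (monomial_ideal (U i))" for i
    by (rule subspace_monomial_ideal) (auto simp: U_def up_closed_def lookup_add)
  have "koszul_acyclic (*) (map mvar vs) s UNIV (monomial_ideal (U i) :: ('n, 'k) mpoly set)"
    if "i + s \<le> length vs" for i
    using that
  proof (induction s arbitrary: i)
    case 0
    then show ?case by (intro T.koszul_acyclic_0 T.subspace_UNIV sub)
  next
    case (Suc s)
    define v where "v = vs ! i"
    have take: "set (take (Suc i) vs) = insert v (set (take i vs))"
      using Suc.prems by (simp add: take_Suc_conv_app_nth v_def)
    have "v \<notin> set (take i vs)"
      using vs Suc.prems by (auto simp: v_def in_set_conv_nth nth_eq_iff_index_eq)
    moreover have "v \<in> set vs" using Suc.prems by (simp add: v_def)
    ultimately have v: "v \<notin> set (take i vs)" "v \<in> set vs" by blast+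
    show ?case
    proof (rule T.koszul_acyclic_regular_step[where f = "mvar v" and L' = "monomial_ideal (U (Suc i))"])
      show "T.subspace (monomial_ideal (U i) :: ('n, 'k) mpoly set)" by (rule sub)
      show "mvar v \<in> koszul_null (*) (map mvar vs) (Suc s) UNIV
          (monomial_ideal (U i) :: ('n, 'k) mpoly set)"
        by (rule subsetD[OF T.set_subset_koszul_null[OF T.subspace_UNIV sub]]) (use v in simp)
      show "koszul_acyclic (*) (map mvar vs) (Suc s - 1) UNIV (monomial_ideal (U (Suc i)) :: ('n, 'k) mpoly set)"
        using Suc by simp
      show "p \<in> monomial_ideal (U i)" if "mvar v * p \<in> monomial_ideal (U i)" for p :: "('n, 'k) mpoly"
        unfolding monomial_ideal_def
      proof (intro CollectI subsetI)
        fix e assume "e \<in> Poly_Mapping.keys p"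
        then have "Poly_Mapping.single v 1 + e \<in> Poly_Mapping.keys (mvar v * p)"
          by (simp only: in_keys_iff lookup_mvar_mult(1) not_False_eq_True)
        then have "Poly_Mapping.single v 1 + e \<in> U i"
          using that by (auto simp: monomial_ideal_def)
        then obtain j where "j \<in> set (take i vs)" "Poly_Mapping.lookup (Poly_Mapping.single v 1 + e) j > 0"
          by (auto simp: U_def)
        moreover from this v have "j \<noteq> v" by blast
        ultimately show "e \<in> U i" by (auto simp: U_def lookup_add lookup_single when_def)
      qed
      show "p \<in> monomial_ideal (U (Suc i)) \<longleftrightarrow> (\<exists>y\<in>monomial_ideal (U i). \<exists>z. p = y + mvar v * z)"
        for p :: "('n, 'k) mpoly"
      proof
        assume p: "p \<in> monomial_ideal (U (Suc i))"
        have inj: "inj (\<lambda>e :: 'n \<Rightarrow>\<^sub>0 nat. Poly_Mapping.single v 1 + e)" by (simp add: inj_def)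
        \<comment> \<open>Monomials of \<open>p\<close> that involve an earlier variable go to \<open>y\<close>; all others are divisible by \<open>v\<close>.\<close>
        define y where "y = restrict_keys (\<lambda>e. e \<in> U i) p"
        define z where "z = Poly_Mapping.map_key (\<lambda>e. Poly_Mapping.single v 1 + e) (p - y)"
        have y: "y \<in> monomial_ideal (U i)"
          by (auto simp: y_def monomial_ideal_def in_keys_iff restrict_keys.rep_eq split: if_splits)
        have lz: "Poly_Mapping.lookup z e = Poly_Mapping.lookup (p - y) (Poly_Mapping.single v 1 + e)" for e
          unfolding z_def map_key.rep_eq[OF inj] by simp
        have "mvar v * z = p - y"
        proof (rule poly_mapping_eqI)
          fix k
          show "Poly_Mapping.lookup (mvar v * z) k = Poly_Mapping.lookup (p - y) k"
          proof (cases "Poly_Mapping.lookup k v = 0")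
            case True
            have "Poly_Mapping.lookup (p - y) k = 0"
            proof (cases "k \<in> U i")
              case False
              then have "k \<notin> U (Suc i)" using True by (auto simp: U_def take)
              then have "k \<notin> Poly_Mapping.keys p" using p by (auto simp: monomial_ideal_def)
              then show ?thesis by (simp add: lookup_minus y_def restrict_keys.rep_eq in_keys_iff)
            qed (simp add: lookup_minus y_def restrict_keys.rep_eq)
            then show ?thesis using True by (simp add: lookup_mvar_mult(2))
          next
            case False
            then obtain e where "k = Poly_Mapping.single v 1 + e"
              using exponent_split_single[of k v] by blast
            then show ?thesis by (simp only: lookup_mvar_mult(1) lz)
          qed
        qed
        then have "p = y + mvar v * z" by simp
        with y show "\<exists>y\<in>monomial_ideal (U i). \<exists>z. p = y + mvar v * z" by blast
      next
        assume "\<exists>y\<in>monomial_ideal (U i). \<exists>z. p = y + mvar v * z"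
        then obtain y z where y: "y \<in> monomial_ideal (U i)" and p: "p = y + mvar v * z" by blast
        have "U i \<subseteq> U (Suc i)" by (auto simp: U_def take)
        then have y': "y \<in> monomial_ideal (U (Suc i))" using y by (auto simp: monomial_ideal_def)
        have "mvar v * z \<in> monomial_ideal (U (Suc i))"
          unfolding monomial_ideal_def
        proof (intro CollectI subsetI)
          fix k assume "k \<in> Poly_Mapping.keys (mvar v * z)"
          then have "Poly_Mapping.lookup k v \<noteq> 0" using lookup_mvar_mult(2) by (force simp: in_keys_iff)
          then show "k \<in> U (Suc i)" by (auto simp: U_def take)
        qed
        then show "p \<in> monomial_ideal (U (Suc i))"
          unfolding p using T.subspace_add[OF sub y'] by blast
      qed
    qed
  qed
  from this[of 0] s show ?thesis by (simp add: U_def monomial_ideal_def)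
qed

section \<open>The neighborhood ideal\<close>

definition squarefree_exponent :: "'n::finite set \<Rightarrow> ('n \<Rightarrow>\<^sub>0 nat)"
  where "squarefree_exponent W = (\<Sum>j\<in>W. Poly_Mapping.single j 1)"

lemma lookup_squarefree_exponent:
  "Poly_Mapping.lookup (squarefree_exponent W) i = (if i \<in> W then 1 else 0)"
  by (simp add: squarefree_exponent_def lookup_sum lookup_single when_def)

lemma squarefree_monomial_eq:
  "squarefree_monomial W = (Poly_Mapping.single (squarefree_exponent W) 1 :: ('n::finite, 'k::field) mpoly)"
proof -
  have "finite W" by simp
  then show ?thesis unfolding squarefree_monomial_def squarefree_exponent_def
    by induction (simp_all add: mvar_def mult_single)
qed

text \<open>The exponents of the monomials in the neighborhood ideal, written out as the condition that one of
the squarefree generators divides the monomial.\<close>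

definition neighborhood_exponents :: "'n::finite set set \<Rightarrow> ('n \<Rightarrow> nat) \<Rightarrow> ('n \<Rightarrow>\<^sub>0 nat) set"
  where "neighborhood_exponents E k =
    {e. \<exists>i W. W \<subseteq> closed_neighborhood E i \<and> card W = k i \<and> (\<forall>j\<in>W. Poly_Mapping.lookup e j > 0)}"

lemma squarefree_monomial_in_iff:
  "squarefree_monomial V \<in> (monomial_ideal (neighborhood_exponents E k) :: ('n::finite, 'k::field) mpoly set)
    \<longleftrightarrow> (\<exists>i W. W \<subseteq> closed_neighborhood E i \<and> card W = k i \<and> W \<subseteq> V)"
proof -
  have "(\<forall>j\<in>W. Poly_Mapping.lookup (squarefree_exponent V) j > 0) \<longleftrightarrow> W \<subseteq> V" for W
    by (auto simp: lookup_squarefree_exponent split: if_splits)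
  then show ?thesis
    by (simp add: monomial_ideal_def squarefree_monomial_eq neighborhood_exponents_def)
qed

lemma up_closed_neighborhood_exponents: "up_closed (neighborhood_exponents E k)"
  unfolding up_closed_def neighborhood_exponents_def by (fastforce simp: lookup_add)

lemma sum_single_keys:
  "(\<Sum>e\<in>Poly_Mapping.keys p. Poly_Mapping.single e (Poly_Mapping.lookup p e)) = p"
  by (rule poly_mapping_eqI) (simp add: lookup_sum lookup_single when_def in_keys_iff)

lemma neighborhood_ideal_eq:
  "neighborhood_ideal E k =
    (monomial_ideal (neighborhood_exponents E k) :: ('n::finite, 'k::field) mpoly set)"
proof
  let ?M = "monomial_ideal (neighborhood_exponents E k) :: ('n, 'k) mpoly set"
  interpret T: Modules.module "(*) :: ('n, 'k) mpoly \<Rightarrow> ('n, 'k) mpoly \<Rightarrow> ('n, 'k) mpoly"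
    by (rule module_times)
  interpret R: cring "mpoly_ring :: ('n, 'k) mpoly ring" by (rule cring_from_type_algebra)
  have M: "T.subspace ?M" by (rule subspace_monomial_ideal[OF up_closed_neighborhood_exponents])
  have "neighborhood_ideal_at E k i \<subseteq> ?M" for i
    unfolding neighborhood_ideal_at_def
  proof (rule R.genideal_minimal)
    show "ideal ?M mpoly_ring" using M by (simp add: ideal_ring_of_type_algebra_iff)
    show "{squarefree_monomial W |W. W \<subseteq> closed_neighborhood E i \<and> card W = k i} \<subseteq> ?M"
      using squarefree_monomial_in_iff by blast
  qed
  then have "(\<Sum>i\<in>UNIV. f i) \<in> ?M" if "\<forall>i. f i \<in> neighborhood_ideal_at E k i" for f
    using that by (intro T.subspace_sum[OF M]) blast
  then show "neighborhood_ideal E k \<subseteq> ?M"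
    unfolding neighborhood_ideal_def by auto
  have at: "T.subspace (neighborhood_ideal_at E k i :: ('n, 'k) mpoly set)" for i
    unfolding neighborhood_ideal_at_def ideal_ring_of_type_algebra_iff[symmetric]
    by (rule R.genideal_ideal) (simp add: ring_of_type_algebra_def)
  have NI: "T.subspace (neighborhood_ideal E k :: ('n, 'k) mpoly set)"
  proof (rule T.subspaceI)
    show "0 \<in> (neighborhood_ideal E k :: ('n, 'k) mpoly set)"
      unfolding neighborhood_ideal_def
      by (rule CollectI, rule exI[of _ "\<lambda>_. 0"]) (simp add: T.subspace_0[OF at])
  next
    fix p q :: "('n, 'k) mpoly"
    assume "p \<in> neighborhood_ideal E k" "q \<in> neighborhood_ideal E k"
    then obtain f g where "p = (\<Sum>i\<in>UNIV. f i)" "\<And>i. f i \<in> neighborhood_ideal_at E k i"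
      "q = (\<Sum>i\<in>UNIV. g i)" "\<And>i. g i \<in> neighborhood_ideal_at E k i"
      unfolding neighborhood_ideal_def by blast
    then show "p + q \<in> neighborhood_ideal E k"
      unfolding neighborhood_ideal_def
      by (intro CollectI exI[of _ "\<lambda>i. f i + g i"]) (simp add: sum.distrib T.subspace_add[OF at])
  next
    fix c p :: "('n, 'k) mpoly"
    assume "p \<in> neighborhood_ideal E k"
    then obtain f where "p = (\<Sum>i\<in>UNIV. f i)" "\<And>i. f i \<in> neighborhood_ideal_at E k i"
      unfolding neighborhood_ideal_def by blast
    then show "c * p \<in> neighborhood_ideal E k"
      unfolding neighborhood_ideal_def
      by (intro CollectI exI[of _ "\<lambda>i. c * f i"]) (simp add: sum_distrib_left T.subspace_scale[OF at])
  qed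
  show "?M \<subseteq> neighborhood_ideal E k"
  proof
    fix p assume p: "p \<in> ?M"
    have "Poly_Mapping.single e c \<in> neighborhood_ideal E k"
      if e: "e \<in> neighborhood_exponents E k" for e and c :: 'k
    proof -
      obtain i W where W: "W \<subseteq> closed_neighborhood E i" "card W = k i" "\<forall>j\<in>W. Poly_Mapping.lookup e j > 0"
        using e unfolding neighborhood_exponents_def by blast
      have "squarefree_monomial W \<in> (neighborhood_ideal_at E k i :: ('n, 'k) mpoly set)"
        unfolding neighborhood_ideal_at_def
        by (rule subsetD[OF R.genideal_self]) (use W in \<open>auto simp: ring_of_type_algebra_def\<close>)
      moreover obtain d where d: "e = squarefree_exponent W + d"
        by (rule exponent_split[of "squarefree_exponent W" e])
          (use W(3) in \<open>auto simp: le_fun_def lookup_squarefree_exponent Suc_leI\<close>)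
      moreover have "Poly_Mapping.single e c = Poly_Mapping.single d c * squarefree_monomial W"
        by (simp add: squarefree_monomial_eq mult_single d add.commute)
      ultimately have ei: "Poly_Mapping.single e c \<in> neighborhood_ideal_at E k i"
        using T.subspace_scale[OF at] by simp
      show ?thesis
        unfolding neighborhood_ideal_def
        by (intro CollectI exI[of _ "\<lambda>i'. if i' = i then Poly_Mapping.single e c else 0"])
          (simp add: ei T.subspace_0[OF at])
    qed
    then have "(\<Sum>e\<in>Poly_Mapping.keys p. Poly_Mapping.single e (Poly_Mapping.lookup p e)) \<in> neighborhood_ideal E k"
      using p by (intro T.subspace_sum[OF NI]) (auto simp: monomial_ideal_def)
    then show "p \<in> neighborhood_ideal E k" by (simp add: sum_single_keys)
  qed
qed

text \<open>The generators that come from vertex \<open>i\<close> have degree \<open>k i = m i + 1\<close>, more than the number of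
elements of \<open>C\<close> in the closed neighborhood of \<open>i\<close>.\<close>

lemma squarefree_monomial_cover_notin:
  assumes m: "\<forall>i. m i = int (k i) - 1" and C: "m_vertex_cover E m C"
  shows "squarefree_monomial C \<notin> (neighborhood_ideal E k :: ('n::finite, 'k::field) mpoly set)"
proof
  assume "squarefree_monomial C \<in> (neighborhood_ideal E k :: ('n, 'k) mpoly set)"
  then obtain i W where W: "W \<subseteq> closed_neighborhood E i" "card W = k i" "W \<subseteq> C"
    unfolding neighborhood_ideal_eq squarefree_monomial_in_iff by blast
  have "card W \<le> card (closed_neighborhood E i \<inter> C)"
    by (rule card_mono) (use W in auto)
  moreover have "int (card (closed_neighborhood E i \<inter> C)) \<le> int (k i) - 1"
    using C m unfolding m_vertex_cover_def by (cases "i \<in> C") auto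
  ultimately show False using W(2) by simp
qed

text \<open>A vertex outside \<open>C\<close> has exactly \<open>k i - 1\<close> elements of \<open>C\<close> in its closed neighborhood, so adding the
vertex itself gives the support of a generator.\<close>

lemma mvar_squarefree_monomial_cover_in:
  assumes m: "\<forall>i. m i = int (k i) - 1" and C: "m_vertex_cover E m C"
    and i: "i \<notin> C"
  shows "mvar i * squarefree_monomial C \<in> (neighborhood_ideal E k :: ('n::finite, 'k::field) mpoly set)"
proof -
  let ?W = "insert i (closed_neighborhood E i \<inter> C)"
  have "int (card (closed_neighborhood E i \<inter> C)) = int (k i) - 1"
    using C m i unfolding m_vertex_cover_def by simp
  then have "card ?W = k i" using i by simp
  moreover have "?W \<subseteq> closed_neighborhood E i" by (auto simp: closed_neighborhood_def)
  moreover have "mvar i * squarefree_monomial C = (squarefree_monomial (insert i C) :: ('n, 'k) mpoly)"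
    using i by (simp add: squarefree_monomial_def)
  ultimately show ?thesis
    by (simp only: neighborhood_ideal_eq squarefree_monomial_in_iff) blast
qed

section \<open>Projective resolutions\<close>

text \<open>All modules in a projective resolution are embedded in free modules, whose elements are functions on
the index set. The whole argument then takes place in the function type with this scalar
multiplication.\<close>

definition scale_fun :: "'a::comm_ring_1 \<Rightarrow> ('u \<Rightarrow> 'a) \<Rightarrow> 'u \<Rightarrow> 'a"
  where "scale_fun a f = (\<lambda>u. a * f u)"

lemma module_scale_fun: "Modules.module (scale_fun :: 'a::comm_ring_1 \<Rightarrow> ('u \<Rightarrow> 'a) \<Rightarrow> 'u \<Rightarrow> 'a)"
  by unfold_locales (simp_all add: scale_fun_def fun_eq_iff algebra_simps)

abbreviation free_carrier :: "'u set \<Rightarrow> ('u \<Rightarrow> 'a::comm_ring_1) set"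
  where "free_carrier A \<equiv> carrier (free_module (ring_of_type_algebra :: 'a ring) A)"

lemma free_module_simps:
  "f \<in> free_carrier A \<longleftrightarrow> (\<forall>u. u \<notin> A \<longrightarrow> f u = 0) \<and> finite {u. f u \<noteq> (0::'a::comm_ring_1)}"
  "f \<oplus>\<^bsub>free_module ring_of_type_algebra A\<^esub> g = f + g"
  "a \<odot>\<^bsub>free_module ring_of_type_algebra A\<^esub> f = scale_fun a f"
  by (auto simp: free_module_def ring_of_type_algebra_def scale_fun_def plus_fun_def)

lemma subspace_free_carrier:
  "Modules.module.subspace scale_fun (free_carrier A :: ('u \<Rightarrow> 'a::comm_ring_1) set)"
  unfolding Modules.module.subspace_def[OF module_scale_fun]
proof (intro conjI ballI allI)
  fix f g :: "'u \<Rightarrow> 'a" and a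
  assume f: "f \<in> free_carrier A"
  show "f + g \<in> free_carrier A" if "g \<in> free_carrier A"
    using f that unfolding free_module_simps
    by (auto intro: finite_subset[of _ "{u. f u \<noteq> 0} \<union> {u. g u \<noteq> 0}"])
  show "scale_fun a f \<in> free_carrier A"
    using f unfolding free_module_simps scale_fun_def
    by (auto intro: finite_subset[of _ "{u. f u \<noteq> 0}"])
qed (simp add: free_module_simps)

text \<open>The differential acts on each coordinate separately, so a primitive can be chosen coordinate by
coordinate. Choosing it to be zero at the coordinates where the cocycle vanishes keeps the support
finite, as only finitely many values of the cocycle are nonzero.\<close>

lemma koszul_acyclic_free:
  fixes xs :: "'a::comm_ring_1 list" and A :: "'u set"
  assumes ac: "koszul_acyclic (*) xs s UNIV {0}"
  shows "koszul_acyclic scale_fun xs s (free_carrier A) {0}"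
  unfolding koszul_acyclic_def
proof (intro ballI impI)
  let ?n = "length xs"
  interpret F: Modules.module "scale_fun :: 'a \<Rightarrow> ('u \<Rightarrow> 'a) \<Rightarrow> 'u \<Rightarrow> 'a" by (rule module_scale_fun)
  interpret T: Modules.module "(*) :: 'a \<Rightarrow> 'a \<Rightarrow> 'a" by (rule module_times)
  fix c :: "bool list \<Rightarrow> 'u \<Rightarrow> 'a"
  assume c: "c \<in> cochains ?n s (free_carrier A)" and dc: "\<forall>l. koszul_d scale_fun xs c l \<in> {0}"
  have coord: "koszul_d (*) xs (\<lambda>l. w l u) l = koszul_d scale_fun xs w l u" for w :: "bool list \<Rightarrow> 'u \<Rightarrow> 'a" and u l
    by (rule koszul_d_map[of w UNIV "\<lambda>g. g u" xs scale_fun "(*)" l, THEN conjunct1])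
      (simp_all add: scale_fun_def)
  have "\<exists>v\<in>cochains ?n (s - 1) UNIV. \<forall>l. c l u - koszul_d (*) xs v l \<in> {0}" for u
  proof -
    have "(\<lambda>l. c l u) \<in> cochains ?n s UNIV" by (rule cochains_map[OF c]) simp_all
    moreover have "\<forall>l. koszul_d (*) xs (\<lambda>l. c l u) l \<in> {0}" using dc by (simp add: coord)
    ultimately show ?thesis using ac unfolding koszul_acyclic_def by blast
  qed
  then have "\<forall>u. \<exists>v. v \<in> cochains ?n (s - 1) UNIV \<and> (\<forall>l. c l u = koszul_d (*) xs v l)" by auto
  then obtain v where v: "\<And>u. v u \<in> cochains ?n (s - 1) UNIV" "\<And>u l. c l u = koszul_d (*) xs (v u) l"
    using choice[of "\<lambda>u v. v \<in> cochains ?n (s - 1) UNIV \<and> (\<forall>l. c l u = koszul_d (*) xs v l)"] by blast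
  define B where "B = (\<Union>l\<in>{l. length l = ?n}. {u. c l u \<noteq> 0})"
  have cl: "c l \<in> free_carrier A" "c l \<noteq> 0 \<Longrightarrow> length l = ?n" for l using c by (auto simp: cochains_def)
  have c0: "c l u = 0" if "u \<notin> B" for l u
  proof (cases "length l = ?n")
    case True
    then show ?thesis using that by (auto simp: B_def)
  next
    case False
    then have "c l = 0" using cl(2) by blast
    then show ?thesis by simp
  qed
  have "finite {l :: bool list. length l = ?n}"
    using finite_lists_length_eq[of "UNIV :: bool set" ?n] by simp
  then have B: "finite B" "B \<subseteq> A" using cl(1) unfolding free_module_simps B_def by auto
  define w where "w l = (\<lambda>u. if u \<in> B then v u l else 0)" for l
  have "w \<in> cochains ?n (s - 1) (free_carrier A)"
    unfolding cochains_def
  proof (intro CollectI allI conjI impI)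
    fix l
    show "w l \<in> free_carrier A"
      using B unfolding free_module_simps w_def by (auto intro: finite_subset[of _ B])
    assume "w l \<noteq> 0"
    then obtain u where "v u l \<noteq> 0" by (auto simp: w_def fun_eq_iff split: if_splits)
    then show "length l = ?n" "count_list l True < s - 1" using v(1)[of u] unfolding cochains_def by auto
  qed
  moreover have "koszul_d scale_fun xs w l = c l" for l
  proof (rule ext)
    fix u
    show "koszul_d scale_fun xs w l u = c l u"
      unfolding coord[symmetric] w_def
      by (cases "u \<in> B") (simp_all add: v(2)[symmetric] T.koszul_d_zero c0)
  qed
  ultimately show "\<exists>w\<in>cochains ?n (s - 1) (free_carrier A). \<forall>l. c l - koszul_d scale_fun xs w l \<in> {0}"
    by (intro bexI[of _ w]) simp_all
qed

text \<open>Koszul cohomology is an additive functor, so vanishing passes to direct summands.\<close>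

lemma (in Modules.module) koszul_acyclic_retract:
  assumes N: "subspace N"
    and f_diff: "\<And>x y. x \<in> N \<Longrightarrow> y \<in> N \<Longrightarrow> f (x - y) = f x - f y"
    and f_scale: "\<And>r x. x \<in> N \<Longrightarrow> f (r *s x) = r *s f x"
    and Q: "Q \<subseteq> N" "\<And>x. x \<in> N \<Longrightarrow> f x \<in> Q" "\<And>x. x \<in> Q \<Longrightarrow> f x = x"
    and ac: "koszul_acyclic scale xs s N {0}"
  shows "koszul_acyclic scale xs s Q {0}"
  unfolding koszul_acyclic_def
proof (intro ballI impI)
  let ?n = "length xs"
  fix c assume c: "c \<in> cochains ?n s Q" and dc: "\<forall>l. koszul_d scale xs c l \<in> {0}"
  have f0: "f 0 = 0" using f_diff[of 0 0] subspace_0[OF N] by simp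
  obtain v where v: "v \<in> cochains ?n (s - 1) N" "\<forall>l. c l - koszul_d scale xs v l \<in> {0}"
    using ac cochains_mono[OF c order_refl Q(1)] dc unfolding koszul_acyclic_def by blast
  have "koszul_d scale xs (\<lambda>l. f (v l)) l = f (koszul_d scale xs v l)" for l
    by (rule koszul_d_map[of v N f xs scale scale l, THEN conjunct1])
      (use v(1) f0 f_diff f_scale subspace_0[OF N] subspace_scale[OF N] subspace_diff[OF N]
        in \<open>auto simp: cochains_def\<close>)
  moreover have "f (koszul_d scale xs v l) = c l" for l
    using v(2) c Q(3)[of "c l"] by (simp add: cochains_def)
  moreover have "(\<lambda>l. f (v l)) \<in> cochains ?n (s - 1) Q"
    using cochains_map[OF v(1)] Q(2) f0 by blast
  ultimately show "\<exists>v\<in>cochains ?n (s - 1) Q. \<forall>l. c l - koszul_d scale xs v l \<in> {0}"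
    by (intro bexI[of _ "\<lambda>l. f (v l)"]) simp_all
qed

lemma module_homD:
  assumes "h \<in> module_hom R M N"
  shows "x \<in> carrier M \<Longrightarrow> h x \<in> carrier N"
    and "x \<in> carrier M \<Longrightarrow> y \<in> carrier M \<Longrightarrow> h (x \<oplus>\<^bsub>M\<^esub> y) = h x \<oplus>\<^bsub>N\<^esub> h y"
    and "a \<in> carrier R \<Longrightarrow> x \<in> carrier M \<Longrightarrow> h (a \<odot>\<^bsub>M\<^esub> x) = a \<odot>\<^bsub>N\<^esub> h x"
  using assms unfolding module_hom_def by auto

text \<open>A resolution of length \<open>d < r\<close> leaves \<open>r - d \<ge> 1\<close> degrees of vanishing for \<open>M\<close>. In degree \<open>0\<close>
this concerns the elements of \<open>M\<close> killed by \<open>xs\<close>, and these appear here through their lifts \<open>p\<close>.\<close>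

lemma koszul_regular_kernel_of_short_resolution:
  fixes P :: "nat \<Rightarrow> ('a::comm_ring_1, 'u) module" and M :: "('a, 'b) module" and xs :: "'a list"
  assumes res: "projective_resolution ring_of_type_algebra M P \<delta> \<epsilon>"
    and len: "\<forall>i>d. carrier (P i) = {\<zero>\<^bsub>P i\<^esub>}" "d < r"
    and ac: "\<And>s. s \<le> r \<Longrightarrow> koszul_acyclic (*) xs s UNIV {0}"
    and p: "p \<in> carrier (P 0)" "\<And>x. x \<in> set xs \<Longrightarrow> x \<odot>\<^bsub>P 0\<^esub> p \<in> a_kernel (P 0) M \<epsilon>"
  shows "p \<in> a_kernel (P 0) M \<epsilon>"
proof -
  let ?R = "ring_of_type_algebra :: 'a ring"
  interpret F: Modules.module "scale_fun :: 'a \<Rightarrow> ('u \<Rightarrow> 'a) \<Rightarrow> 'u \<Rightarrow> 'a" by (rule module_scale_fun)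
  have R [simp]: "carrier ?R = UNIV" by (simp add: ring_of_type_algebra_def)
  have P: "module ?R (P i)" for i
    using res unfolding projective_resolution_def projective_module_def by blast
  have "\<forall>i. \<exists>(A :: 'u set) \<iota> \<pi>. \<iota> \<in> module_hom ?R (P i) (free_module ?R A) \<and>
       \<pi> \<in> module_hom ?R (free_module ?R A) (P i) \<and> (\<forall>x\<in>carrier (P i). \<pi> (\<iota> x) = x)"
    using res unfolding projective_resolution_def projective_module_def by blast
  then obtain A :: "nat \<Rightarrow> 'u set" and \<iota> \<pi> where \<iota>: "\<And>i. \<iota> i \<in> module_hom ?R (P i) (free_module ?R (A i))"
    and \<pi>: "\<And>i. \<pi> i \<in> module_hom ?R (free_module ?R (A i)) (P i)"
    and \<pi>\<iota>: "\<And>i x. x \<in> carrier (P i) \<Longrightarrow> \<pi> i (\<iota> i x) = x"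
    by metis
  have \<delta>: "\<delta> i \<in> module_hom ?R (P (Suc i)) (P i)" for i
    using res unfolding projective_resolution_def by blast
  have \<delta>0: "\<delta> 0 ` carrier (P (Suc 0)) = a_kernel (P 0) M \<epsilon>"
    and \<delta>S: "\<And>i. \<delta> (Suc i) ` carrier (P (Suc (Suc i))) = a_kernel (P (Suc i)) (P i) (\<delta> i)"
    using res unfolding projective_resolution_def by blast+
  note \<iota>D = module_homD[OF \<iota>, unfolded free_module_simps R]
  note \<pi>D = module_homD[OF \<pi>, unfolded free_module_simps(2,3) R]
  note \<delta>D = module_homD[OF \<delta>, unfolded R]
  have zero: "\<zero>\<^bsub>P i\<^esub> \<in> carrier (P i)" for i
    using P[of i] by (meson abelian_group.axioms(1) abelian_monoid.zero_closed module.axioms(2))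
  have add: "x \<oplus>\<^bsub>P i\<^esub> y \<in> carrier (P i)" if "x \<in> carrier (P i)" "y \<in> carrier (P i)" for i x y
    using P[of i] that by (meson abelian_group.axioms(1) abelian_monoid.a_closed module.axioms(2))
  have smult: "a \<odot>\<^bsub>P i\<^esub> x \<in> carrier (P i)" if "x \<in> carrier (P i)" for i x a
    using module.smult_closed[OF P[of i]] that by simp
  have smult0: "0 \<odot>\<^bsub>P i\<^esub> x = \<zero>\<^bsub>P i\<^esub>" if "x \<in> carrier (P i)" for i x
    using module.smult_l_null[OF P[of i] that] by (simp add: ring_of_type_algebra_def)
  \<comment> \<open>\<open>Q i\<close> and \<open>K i\<close> are the copies in a free module of \<open>P i\<close> and of the image of \<open>\<delta> i\<close>; \<open>\<phi> i\<close> is the copy of \<open>\<delta> i\<close>.\<close>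
  define Q where "Q i = \<iota> i ` carrier (P i)" for i
  define K where "K i = \<iota> i ` \<delta> i ` carrier (P (Suc i))" for i
  define \<phi> where "\<phi> i q = \<iota> i (\<delta> i (\<pi> (Suc i) q))" for i q
  have \<phi>\<iota>: "\<phi> i (\<iota> (Suc i) x) = \<iota> i (\<delta> i x)" if "x \<in> carrier (P (Suc i))" for i x
    using \<pi>\<iota>[OF that] by (simp add: \<phi>_def)
  have \<iota>0: "\<iota> i \<zero>\<^bsub>P i\<^esub> = 0" for i
    using \<iota>D(3)[where a = 0, OF UNIV_I zero[of i]] smult0[OF zero] by simp
  have inj: "x = y" if "\<iota> i x = \<iota> i y" "x \<in> carrier (P i)" "y \<in> carrier (P i)" for i x y
    using \<pi>\<iota> that by metis
  have QF: "Q i \<subseteq> free_carrier (A i)" for i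
    using module_homD(1)[OF \<iota>] unfolding Q_def by blast
  have Q: "F.subspace (Q i)" for i
  proof (rule F.subspaceI)
    show "0 \<in> Q i" unfolding Q_def using \<iota>0 zero by (metis image_eqI)
    show "x + y \<in> Q i" if "x \<in> Q i" "y \<in> Q i" for x y
      using that \<iota>D(2)[symmetric] add unfolding Q_def by auto
    show "scale_fun a x \<in> Q i" if "x \<in> Q i" for a x
      using that \<iota>D(3)[symmetric] smult unfolding Q_def by auto
  qed
  have acQ: "koszul_acyclic scale_fun xs s (Q i) {0}" if "s \<le> r" for s i
  proof (rule F.koszul_acyclic_retract[where N = "free_carrier (A i)" and f = "\<lambda>q. \<iota> i (\<pi> i q)"])
    show "F.subspace (free_carrier (A i))" by (rule subspace_free_carrier)
    show "koszul_acyclic scale_fun xs s (free_carrier (A i)) {0}"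
      by (rule koszul_acyclic_free[OF ac[OF that]])
    have lin: "\<iota> i (\<pi> i (x + y)) = \<iota> i (\<pi> i x) + \<iota> i (\<pi> i y)"
      "\<iota> i (\<pi> i (scale_fun a x)) = scale_fun a (\<iota> i (\<pi> i x))"
      if "x \<in> free_carrier (A i)" "y \<in> free_carrier (A i)" for x y a
      using that by (simp_all add: \<pi>D \<iota>D)
    show "\<iota> i (\<pi> i (scale_fun a x)) = scale_fun a (\<iota> i (\<pi> i x))" if "x \<in> free_carrier (A i)" for a x
      using lin(2)[OF that that] .
    show "\<iota> i (\<pi> i (x - y)) = \<iota> i (\<pi> i x) - \<iota> i (\<pi> i y)"
      if "x \<in> free_carrier (A i)" "y \<in> free_carrier (A i)" for x y
      using lin(1)[OF F.subspace_diff[OF subspace_free_carrier that] that(2)] by simp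
    show "Q i \<subseteq> free_carrier (A i)" by (rule QF)
    show "\<iota> i (\<pi> i x) \<in> Q i" if "x \<in> free_carrier (A i)" for x
      using that \<pi>D(1) by (auto simp: Q_def)
    show "\<iota> i (\<pi> i x) = x" if "x \<in> Q i" for x
      using that \<pi>\<iota> by (auto simp: Q_def)
  qed
  have K\<phi>: "K i = \<phi> i ` Q (Suc i)" for i
    unfolding K_def Q_def image_image using \<phi>\<iota> by (intro image_cong) simp_all
  have \<phi>_lin: "\<phi> i (x + y) = \<phi> i x + \<phi> i y" "\<phi> i (scale_fun a x) = scale_fun a (\<phi> i x)"
    if xy: "x \<in> Q (Suc i)" "y \<in> Q (Suc i)" for i x y a
  proof -
    obtain p q where pq: "x = \<iota> (Suc i) p" "y = \<iota> (Suc i) q" "p \<in> carrier (P (Suc i))" "q \<in> carrier (P (Suc i))"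
      using xy unfolding Q_def by blast
    have "\<phi> i (x + y) = \<phi> i (\<iota> (Suc i) (p \<oplus>\<^bsub>P (Suc i)\<^esub> q))" using pq by (simp add: \<iota>D)
    also have "\<dots> = \<iota> i (\<delta> i (p \<oplus>\<^bsub>P (Suc i)\<^esub> q))" using pq add by (intro \<phi>\<iota>) simp
    finally show "\<phi> i (x + y) = \<phi> i x + \<phi> i y" using pq by (simp add: \<iota>D \<delta>D \<phi>\<iota>)
    have "\<phi> i (scale_fun a x) = \<phi> i (\<iota> (Suc i) (a \<odot>\<^bsub>P (Suc i)\<^esub> p))" using pq by (simp add: \<iota>D)
    also have "\<dots> = \<iota> i (\<delta> i (a \<odot>\<^bsub>P (Suc i)\<^esub> p))" using pq smult by (intro \<phi>\<iota>) simp
    finally show "\<phi> i (scale_fun a x) = scale_fun a (\<phi> i x)" using pq by (simp add: \<iota>D \<delta>D \<phi>\<iota>)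
  qed
  have \<phi>_diff: "\<phi> i (x - y) = \<phi> i x - \<phi> i y" if xy: "x \<in> Q (Suc i)" "y \<in> Q (Suc i)" for i x y
    using \<phi>_lin(1)[OF F.subspace_diff[OF Q xy] xy(2)] by simp
  have ker: "{q \<in> Q (Suc i). \<phi> i q = 0} = K (Suc i)" for i
  proof -
    have "\<phi> i (\<iota> (Suc i) x) = 0 \<longleftrightarrow> x \<in> a_kernel (P (Suc i)) (P i) (\<delta> i)" if x: "x \<in> carrier (P (Suc i))" for x
      unfolding \<phi>\<iota>[OF x] a_kernel_def'
      using inj[of i "\<delta> i x" "\<zero>\<^bsub>P i\<^esub>"] \<iota>0[of i] \<delta>D(1)[OF x] zero[of i] x by auto
    moreover have "a_kernel (P (Suc i)) (P i) (\<delta> i) \<subseteq> carrier (P (Suc i))" by (auto simp: a_kernel_def')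
    ultimately show ?thesis unfolding K_def \<delta>S Q_def by blast
  qed
  have K: "F.subspace (K i)" for i
  proof (rule F.subspaceI)
    have "\<phi> i 0 = 0" using \<phi>_diff[OF F.subspace_0[OF Q] F.subspace_0[OF Q], of i] by simp
    then show "0 \<in> K i" unfolding K\<phi> using F.subspace_0[OF Q] by (metis image_eqI)
    show "x + y \<in> K i" if "x \<in> K i" "y \<in> K i" for x y
      using that \<phi>_lin(1)[symmetric] F.subspace_add[OF Q] unfolding K\<phi> by auto
    show "scale_fun a x \<in> K i" if "x \<in> K i" for a x
      using that \<phi>_lin(2)[symmetric] F.subspace_scale[OF Q] unfolding K\<phi> by auto
  qed
  have KQ: "K i \<subseteq> Q i" for i unfolding K_def Q_def using \<delta>D(1) by blast
  \<comment> \<open>The cokernel of \<open>\<delta> i\<close> has vanishing cohomology in degrees up to \<open>i\<close>; by downward induction from \<open>d\<close>, where \<open>\<delta> d\<close> is zero.\<close>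
  have "koszul_acyclic scale_fun xs (Suc 0) (Q 0) (K 0)"
  proof (rule inc_induct[of 0 d "\<lambda>i. koszul_acyclic scale_fun xs (Suc i) (Q i) (K i)"])
    have "carrier (P (Suc d)) = {\<zero>\<^bsub>P (Suc d)\<^esub>}" using len by blast
    then have "Q (Suc d) = {0}" by (simp add: Q_def \<iota>0)
    moreover have "\<phi> d 0 = 0" using \<phi>_diff[OF F.subspace_0[OF Q] F.subspace_0[OF Q], of d] by simp
    ultimately have "K d = {0}" by (simp add: K\<phi>)
    then show "koszul_acyclic scale_fun xs (Suc d) (Q d) (K d)" using acQ len by simp
  next
    fix i assume i: "i < d" and IH: "koszul_acyclic scale_fun xs (Suc (Suc i)) (Q (Suc i)) (K (Suc i))"
    have "koszul_acyclic scale_fun xs (Suc (Suc i)) (K i) {0}"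
      unfolding K\<phi>
      by (rule F.koszul_acyclic_image[OF Q]) (simp_all add: \<phi>_diff \<phi>_lin ker IH)
    then show "koszul_acyclic scale_fun xs (Suc i) (Q i) (K i)"
      using F.koszul_acyclic_quotient[OF Q K KQ acQ] i len by simp
  qed simp
  moreover have "scale_fun x (\<iota> 0 p) \<in> K 0" if "x \<in> set xs" for x
    using p(2)[OF that] \<iota>D(3)[where a = x, OF UNIV_I p(1)] unfolding K_def \<delta>0 by (metis UNIV_I image_eqI)
  ultimately have "\<iota> 0 p \<in> K 0"
    using F.koszul_acyclic_1_D[of xs "Q 0" "K 0" "\<iota> 0 p"] K Q p(1) by (simp add: Q_def)
  then obtain q where q: "q \<in> a_kernel (P 0) M \<epsilon>" "\<iota> 0 p = \<iota> 0 q" unfolding K_def \<delta>0 by blast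
  then have "p = q" using inj[of 0 p q] p(1) by (simp add: a_kernel_def')
  then show ?thesis using q by simp
qed

section \<open>Cyclic modules\<close>

definition residue_class :: "'a::comm_ring_1 set \<Rightarrow> 'a \<Rightarrow> 'a set"
  where "residue_class I a = (\<lambda>h. h + a) ` I"

abbreviation cyclic_module :: "'a::comm_ring_1 set \<Rightarrow> ('a, 'a set) module"
  where "cyclic_module I \<equiv> quotient_module (regular_module ring_of_type_algebra) I"

context
  fixes I :: "'a::comm_ring_1 set"
  assumes I: "Modules.module.subspace (*) I"
begin

interpretation T: Modules.module "(*) :: 'a \<Rightarrow> 'a \<Rightarrow> 'a" by (rule module_times)

lemma residue_class_eq_iff: "residue_class I a = residue_class I b \<longleftrightarrow> a - b \<in> I"
proof
  assume eq: "residue_class I a = residue_class I b"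
  have "0 + a \<in> residue_class I a" unfolding residue_class_def using T.subspace_0[OF I] by (rule imageI)
  then show "a - b \<in> I" unfolding eq by (auto simp: residue_class_def)
next
  have sub: "residue_class I a \<subseteq> residue_class I b" if "a - b \<in> I" for a b
  proof
    fix x assume "x \<in> residue_class I a"
    then obtain h where "h \<in> I" "x = h + a" by (auto simp: residue_class_def)
    then have "h + (a - b) \<in> I" "x = (h + (a - b)) + b" using T.subspace_add[OF I _ that] by simp_all
    then show "x \<in> residue_class I b" unfolding residue_class_def by blast
  qed
  assume "a - b \<in> I"
  moreover from T.subspace_neg[OF I this] have "b - a \<in> I" by simp
  ultimately show "residue_class I a = residue_class I b" using sub by blast
qed

lemma residue_class_0: "residue_class I 0 = I"
  by (simp add: residue_class_def)

lemma a_r_coset_regular_module: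
  "I +>\<^bsub>regular_module ring_of_type_algebra\<^esub> a = residue_class I a"
  by (auto simp: a_r_coset_def r_coset_def regular_module_def ring_of_type_algebra_def residue_class_def)

lemma cyclic_module_carrier: "carrier (cyclic_module I) = range (residue_class I)"
  unfolding quotient_module_def
  by (auto simp: A_RCOSETS_def' a_r_coset_regular_module) (auto simp: regular_module_def ring_of_type_algebra_def)

lemma cyclic_module_zero: "\<zero>\<^bsub>cyclic_module I\<^esub> = residue_class I 0"
  by (simp add: quotient_module_def residue_class_0)

lemma cyclic_module_add:
  "residue_class I a \<oplus>\<^bsub>cyclic_module I\<^esub> residue_class I b = residue_class I (a + b)"
proof -
  have "residue_class I a \<oplus>\<^bsub>cyclic_module I\<^esub> residue_class I b =
      {x + y | x y. x \<in> residue_class I a \<and> y \<in> residue_class I b}"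
    by (auto simp: quotient_module_def set_add_def' regular_module_def ring_of_type_algebra_def)
  also have "\<dots> = residue_class I (a + b)"
  proof (intro equalityI subsetI)
    fix z assume "z \<in> {x + y | x y. x \<in> residue_class I a \<and> y \<in> residue_class I b}"
    then obtain h h' where "h \<in> I" "h' \<in> I" "z = (h + h') + (a + b)"
      by (auto simp: residue_class_def)
    then show "z \<in> residue_class I (a + b)"
      unfolding residue_class_def using T.subspace_add[OF I] by blast
  next
    fix z assume "z \<in> residue_class I (a + b)"
    then obtain h where "h \<in> I" "z = (h + a) + (0 + b)" by (auto simp: residue_class_def)
    then show "z \<in> {x + y | x y. x \<in> residue_class I a \<and> y \<in> residue_class I b}"
      unfolding residue_class_def using T.subspace_0[OF I] by blast
  qed
  finally show ?thesis .
qed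

lemma cyclic_module_smult: "r \<odot>\<^bsub>cyclic_module I\<^esub> residue_class I a = residue_class I (r * a)"
proof -
  have "r \<odot>\<^bsub>cyclic_module I\<^esub> residue_class I a = (\<Union>y\<in>residue_class I a. residue_class I (r * y))"
    by (simp add: quotient_module_def a_r_coset_regular_module)
      (simp add: regular_module_def ring_of_type_algebra_def)
  also have "\<dots> = (\<Union>y\<in>residue_class I a. residue_class I (r * a))"
  proof (rule SUP_cong[OF refl])
    fix y assume "y \<in> residue_class I a"
    then have "y - a \<in> I" by (auto simp: residue_class_def)
    then have "r * (y - a) \<in> I" by (rule T.subspace_scale[OF I])
    then show "residue_class I (r * y) = residue_class I (r * a)"
      by (simp add: residue_class_eq_iff right_diff_distrib)
  qed
  also have "\<dots> = residue_class I (r * a)"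
    using T.subspace_0[OF I] by (auto simp: residue_class_def)
  finally show ?thesis .
qed

lemma cyclic_module_abelian_monoid: "abelian_monoid (cyclic_module I)"
  by (rule abelian_monoidI)
    (auto simp: cyclic_module_carrier cyclic_module_zero cyclic_module_add ac_simps)

lemma cyclic_module_finsum:
  assumes "finite J"
  shows "(\<Oplus>\<^bsub>cyclic_module I\<^esub>j\<in>J. residue_class I (f j)) = residue_class I (\<Sum>j\<in>J. f j)"
proof -
  interpret M: abelian_monoid "cyclic_module I" by (rule cyclic_module_abelian_monoid)
  show ?thesis using assms
    by induction (simp_all add: cyclic_module_zero cyclic_module_add cyclic_module_carrier)
qed

text \<open>Translates the submodules occurring in the definition of a regular sequence into ideals of the ring,
where the Koszul complex modulo a submodule lives.\<close>

lemma residue_class_in_seq_submodule_iff: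
  "residue_class I y \<in> seq_submodule (cyclic_module I) xs \<longleftrightarrow>
    (\<exists>p. y - (\<Sum>j<length xs. xs ! j * p j) \<in> I)"
proof -
  have sum: "(\<Oplus>\<^bsub>cyclic_module I\<^esub>j\<in>{..<length xs}. (xs ! j) \<odot>\<^bsub>cyclic_module I\<^esub> residue_class I (p j))
      = residue_class I (\<Sum>j<length xs. xs ! j * p j)" for p
    by (simp only: cyclic_module_smult cyclic_module_finsum finite_lessThan)
  show ?thesis
  proof
    assume "residue_class I y \<in> seq_submodule (cyclic_module I) xs"
    then obtain m where m: "m \<in> {..<length xs} \<rightarrow> carrier (cyclic_module I)"
      and y: "residue_class I y = (\<Oplus>\<^bsub>cyclic_module I\<^esub>j\<in>{..<length xs}. (xs ! j) \<odot>\<^bsub>cyclic_module I\<^esub> m j)"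
      unfolding seq_submodule_def by blast
    have "\<forall>j. \<exists>q. j < length xs \<longrightarrow> m j = residue_class I q"
      using m unfolding cyclic_module_carrier by blast
    then obtain p where p: "\<And>j. j < length xs \<Longrightarrow> m j = residue_class I (p j)" by metis
    have "residue_class I y = (\<Oplus>\<^bsub>cyclic_module I\<^esub>j\<in>{..<length xs}. (xs ! j) \<odot>\<^bsub>cyclic_module I\<^esub> residue_class I (p j))"
      unfolding y
      by (rule abelian_monoid.finsum_cong'[OF cyclic_module_abelian_monoid])
        (auto simp: p cyclic_module_smult cyclic_module_carrier)
    then show "\<exists>p. y - (\<Sum>j<length xs. xs ! j * p j) \<in> I"
      unfolding sum residue_class_eq_iff by blast
  next
    assume "\<exists>p. y - (\<Sum>j<length xs. xs ! j * p j) \<in> I"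
    then obtain p where "residue_class I y = residue_class I (\<Sum>j<length xs. xs ! j * p j)"
      unfolding residue_class_eq_iff by blast
    then have "residue_class I y = (\<Oplus>\<^bsub>cyclic_module I\<^esub>j\<in>{..<length xs}. (xs ! j) \<odot>\<^bsub>cyclic_module I\<^esub> residue_class I (p j))"
      by (simp only: sum)
    moreover have "(\<lambda>j. residue_class I (p j)) \<in> {..<length xs} \<rightarrow> carrier (cyclic_module I)"
      by (auto simp: cyclic_module_carrier)
    ultimately show "residue_class I y \<in> seq_submodule (cyclic_module I) xs"
      unfolding seq_submodule_def
      by (intro CollectI exI[of _ "\<lambda>j. residue_class I (p j)"] conjI)
  qed
qed

text \<open>Vanishing is proved for all quotients by initial segments of the regular sequence at once, starting
from the full sequence, where nothing is claimed, and gaining one degree with each element that is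
taken away.\<close>

lemma koszul_acyclic_regular_sequence:
  assumes reg: "regular_sequence ring_of_type_algebra (cyclic_module I) fs"
    and fs: "set fs \<subseteq> genideal ring_of_type_algebra (set xs)"
    and s: "s \<le> length fs"
  shows "koszul_acyclic (*) xs s UNIV I"
proof -
  define L where "L i = {y. \<exists>p. y - (\<Sum>j<i. fs ! j * p j) \<in> I}" for i
  have LI: "y \<in> L i" if "y - (\<Sum>j<i. fs ! j * p j) \<in> I" for y i p
    unfolding L_def by (rule CollectI, rule exI[of _ p], rule that)
  have L: "T.subspace (L i)" for i
  proof (rule T.subspaceI)
    show "0 \<in> L i" by (rule LI[where p = "\<lambda>_. 0"]) (simp add: T.subspace_0[OF I])
  next
    fix x y assume "x \<in> L i" "y \<in> L i"
    then obtain p q where "x - (\<Sum>j<i. fs ! j * p j) \<in> I" "y - (\<Sum>j<i. fs ! j * q j) \<in> I"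
      by (auto simp: L_def)
    from T.subspace_add[OF I this] have "x + y - (\<Sum>j<i. fs ! j * (p j + q j)) \<in> I"
      by (simp add: distrib_left sum.distrib algebra_simps)
    then show "x + y \<in> L i" by (rule LI)
  next
    fix c x assume "x \<in> L i"
    then obtain p where "x - (\<Sum>j<i. fs ! j * p j) \<in> I" by (auto simp: L_def)
    from T.subspace_scale[OF I this, of c] have "c * x - (\<Sum>j<i. fs ! j * (c * p j)) \<in> I"
      by (simp add: right_diff_distrib sum_distrib_left mult.left_commute del: T.scale_scale)
    then show "c * x \<in> L i" by (rule LI)
  qed
  have null: "f \<in> koszul_null (*) xs s UNIV (L i)" if "f \<in> set fs" for f s i
  proof -
    interpret R: cring "ring_of_type_algebra :: 'a ring" by (rule cring_from_type_algebra)
    have "T.subspace (koszul_null (*) xs s UNIV (L i))"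
      using T.koszul_null_ideal[OF T.subspace_UNIV L] by (intro T.subspaceI) auto
    then have "genideal ring_of_type_algebra (set xs) \<subseteq> koszul_null (*) xs s UNIV (L i)"
      using T.set_subset_koszul_null[OF T.subspace_UNIV L, of xs]
      by (intro R.genideal_minimal) (simp_all add: ideal_ring_of_type_algebra_iff)
    then show ?thesis using fs that by blast
  qed
  have "koszul_acyclic (*) xs s UNIV (L i)" if "i + s \<le> length fs" for i
    using that
  proof (induction s arbitrary: i)
    case 0
    then show ?case by (intro T.koszul_acyclic_0 T.subspace_UNIV L)
  next
    case (Suc s)
    show ?case
    proof (rule T.koszul_acyclic_regular_step[where f = "fs ! i" and L' = "L (Suc i)", OF L])
      show "fs ! i \<in> koszul_null (*) xs (Suc s) UNIV (L i)" using Suc.prems by (intro null) simp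
      show "koszul_acyclic (*) xs (Suc s - 1) UNIV (L (Suc i))" using Suc by simp
      have "residue_class I y \<in> seq_submodule (cyclic_module I) (take i fs) \<longleftrightarrow> y \<in> L i" for y
        using Suc.prems by (simp add: residue_class_in_seq_submodule_iff L_def)
      moreover have "\<forall>m\<in>carrier (cyclic_module I).
          (fs ! i) \<odot>\<^bsub>cyclic_module I\<^esub> m \<in> seq_submodule (cyclic_module I) (take i fs) \<longrightarrow>
          m \<in> seq_submodule (cyclic_module I) (take i fs)"
        using reg Suc.prems unfolding regular_sequence_def by simp
      ultimately show "z \<in> L i" if "fs ! i * z \<in> L i" for z
        using that by (auto simp: cyclic_module_carrier cyclic_module_smult)
      show "x \<in> L (Suc i) \<longleftrightarrow> (\<exists>y\<in>L i. \<exists>z. x = y + fs ! i * z)" for x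
      proof
        assume "x \<in> L (Suc i)"
        then obtain p where "x - fs ! i * p i - (\<Sum>j<i. fs ! j * p j) \<in> I"
          by (auto simp: L_def algebra_simps)
        then have "x - fs ! i * p i \<in> L i" by (rule LI)
        moreover have "x = (x - fs ! i * p i) + fs ! i * p i" by simp
        ultimately show "\<exists>y\<in>L i. \<exists>z. x = y + fs ! i * z" by blast
      next
        assume "\<exists>y\<in>L i. \<exists>z. x = y + fs ! i * z"
        then obtain y z p where "y - (\<Sum>j<i. fs ! j * p j) \<in> I" "x = y + fs ! i * z"
          by (auto simp: L_def)
        then have "x - (\<Sum>j<Suc i. fs ! j * (p(i := z)) j) \<in> I"
          by (simp add: algebra_simps)
        then show "x \<in> L (Suc i)" by (rule LI)
      qed
    qed
  qed
  from this[of 0] s show ?thesis by (simp add: L_def)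
qed

end


section \<open>Projective dimension and depth\<close>

theorem proposition2p6:
  fixes E :: "'n::finite set set"
    and k :: "'n \<Rightarrow> nat"
    and m :: "'n \<Rightarrow> int"
    and C :: "'n set"
  assumes "simple_graph E"
    and "\<forall>i. \<not> isolated_vertex E i"
    and "\<forall>i. 1 \<le> k i \<and> k i \<le> vertex_degree E i + 1"
    and "\<forall>i. m i = int (k i) - 1"
    and "m_vertex_cover E m C"
  shows "proj_dim TYPE('u) mpoly_ring
           (neighborhood_quotient E k :: (('n, 'k::field) mpoly, ('n, 'k) mpoly set) module)
             \<ge> enat (CARD('n) - card C) \<and>
         poly_depth
           (neighborhood_quotient E k :: (('n, 'k) mpoly, ('n, 'k) mpoly set) module)
             \<le> enat (card C)"
proof
  interpret T: Modules.module "(*) :: ('n, 'k) mpoly \<Rightarrow> ('n, 'k) mpoly \<Rightarrow> ('n, 'k) mpoly"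
    by (rule module_times)
  define I :: "('n, 'k) mpoly set" where "I = neighborhood_ideal E k"
  define w :: "('n, 'k) mpoly" where "w = squarefree_monomial C"
  have I: "T.subspace I"
    unfolding I_def neighborhood_ideal_eq
    by (rule subspace_monomial_ideal[OF up_closed_neighborhood_exponents])
  have w: "w \<notin> I" "\<And>i. i \<notin> C \<Longrightarrow> mvar i * w \<in> I"
    unfolding w_def I_def
    using squarefree_monomial_cover_notin mvar_squarefree_monomial_cover_in assms(4,5) by blast+
  have quotient: "neighborhood_quotient E k = cyclic_module I"
    by (simp add: neighborhood_quotient_def I_def)
  obtain zs where zs: "set zs = C" "distinct zs" using finite_distinct_list[of C] by auto
  obtain vs where vs: "set vs = - C" "distinct vs" using finite_distinct_list[of "- C"] by auto
  have len: "length zs = card C" "length vs = CARD('n) - card C"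
    using distinct_card[OF zs(2)] distinct_card[OF vs(2)] zs vs by (simp_all add: Compl_eq_Diff_UNIV card_Diff_subset)
  show "proj_dim TYPE('u) mpoly_ring
      (neighborhood_quotient E k :: (('n, 'k) mpoly, ('n, 'k) mpoly set) module) \<ge> enat (CARD('n) - card C)"
    unfolding proj_dim_def quotient
  proof (rule Inf_greatest, clarify)
    fix d and P :: "nat \<Rightarrow> (('n, 'k) mpoly, 'u) module" and \<delta> \<epsilon>
    assume res: "projective_resolution mpoly_ring (cyclic_module I) P \<delta> \<epsilon>"
      and d: "\<forall>i>d. carrier (P i) = {\<zero>\<^bsub>P i\<^esub>}"
    show "enat (CARD('n) - card C) \<le> enat d"
    proof (rule ccontr)
      assume "\<not> ?thesis"
      then have dr: "d < length vs" by (simp add: len)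
      have \<epsilon>: "\<epsilon> \<in> module_hom mpoly_ring (P 0) (cyclic_module I)"
        "\<epsilon> ` carrier (P 0) = carrier (cyclic_module I)" "module mpoly_ring (P 0)"
        using res unfolding projective_resolution_def projective_module_def by blast+
      obtain p where p: "p \<in> carrier (P 0)" "\<epsilon> p = residue_class I w"
        using \<epsilon>(2) unfolding cyclic_module_carrier[OF I] by (metis image_iff rangeI)
      have ker: "q \<in> a_kernel (P 0) (cyclic_module I) \<epsilon> \<longleftrightarrow> q \<in> carrier (P 0) \<and> y \<in> I"
        if "\<epsilon> q = residue_class I y" for q y
        using that by (simp add: a_kernel_def' cyclic_module_zero[OF I] residue_class_eq_iff[OF I])
      have "p \<in> a_kernel (P 0) (cyclic_module I) \<epsilon>"
      proof (rule koszul_regular_kernel_of_short_resolution[OF res d dr _ p(1)])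
        show "koszul_acyclic (*) (map mvar vs) s UNIV {0 :: ('n, 'k) mpoly}" if "s \<le> length vs" for s
          by (rule koszul_acyclic_variables[OF vs(2) that])
        fix x assume "x \<in> set (map mvar vs :: ('n, 'k) mpoly list)"
        then obtain i where x: "x = mvar i" "i \<notin> C" using vs by auto
        have R: "x \<in> carrier mpoly_ring" by (simp add: ring_of_type_algebra_def)
        have "\<epsilon> (x \<odot>\<^bsub>P 0\<^esub> p) = residue_class I (x * w)"
          using module_homD(3)[OF \<epsilon>(1) R p(1)] p(2) by (simp add: cyclic_module_smult[OF I])
        moreover have "x \<odot>\<^bsub>P 0\<^esub> p \<in> carrier (P 0)"
          by (rule module.smult_closed[OF \<epsilon>(3) R p(1)])
        ultimately show "x \<odot>\<^bsub>P 0\<^esub> p \<in> a_kernel (P 0) (cyclic_module I) \<epsilon>"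
          using ker w(2)[OF x(2)] x(1) by blast
      qed
      then show False using ker[OF p(2)] w(1) by blast
    qed
  qed
  show "poly_depth (neighborhood_quotient E k :: (('n, 'k) mpoly, ('n, 'k) mpoly set) module)
      \<le> enat (card C)"
    unfolding depth_def quotient
  proof (rule Sup_least, clarify)
    fix fs :: "('n, 'k) mpoly list"
    assume reg: "regular_sequence mpoly_ring (cyclic_module I) fs" and fs: "set fs \<subseteq> irrelevant_ideal"
    show "enat (length fs) \<le> enat (card C)"
    proof (rule ccontr)
      assume "\<not> ?thesis"
      then have l: "length zs + 1 \<le> length fs" by (simp add: len)
      have "range mvar = set (map mvar (zs @ vs) :: ('n, 'k) mpoly list)"
        using zs(1) vs(1) by auto
      then have "koszul_acyclic (*) (map mvar (zs @ vs)) (length zs + 1) UNIV I"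
        using fs by (intro koszul_acyclic_regular_sequence[OF I reg _ l]) (simp add: irrelevant_ideal_def)
      moreover have "distinct (zs @ vs)" using zs vs by auto
      ultimately have "koszul_acyclic (*) (map mvar vs) 1 UNIV I"
        unfolding I_def neighborhood_ideal_eq
        using koszul_acyclic_drop_variables[OF up_closed_neighborhood_exponents] by blast
      then have "w \<in> I"
        by (rule T.koszul_acyclic_1_D[OF _ T.subspace_UNIV I UNIV_I]) (use vs w(2) in auto)
      then show False using w(1) by blast
    qed
  qed
qed

end
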